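(* Let $n\geqslant 2$ and $1<p<n$. There is a positive constant $c_0$ depending only on $n$ and $p$ such that the following holds. Let $Q:\mathbb{B}^n\to[0,\infty]$ be a locally integrable function in $\mathbb{B}^n$ satisfying $$Q_0:=\liminf_{\varepsilon\to 0}\frac{1}{\Omega_n\varepsilon^n}\int_{B(0,\varepsilon)}Q(x)\,dm(x)<\infty,$$ and let $f:\mathbb{B}^n\to\mathbb{B}^n$ be an open discrete ring $(p,Q)$-mapping with $f(0)=0$. Then $$\liminf_{x\to 0}\frac{|f(x)|}{|x|}\leqslant c_0\,Q_0^{\frac{1}{n-p}}.$$
   Context: Notation: $m$ is Lebesgue measure in $\mathbb{R}^n$; $B(x_0,r)=\{x\in\mathbb{R}^n:|x-x_0|<r\}$, $S(x_0,r)=\{x\in\mathbb{R}^n:|x-x_0|=r\}$, $A(r_1,r_2,x_0)=\{x\in\mathbb{R}^n:r_1<|x-x_0|<r_2\}$, $\mathbb{B}^n=B(0,1)$, $\Omega_n=m(\mathbb{B}^n)$. Mappings are continuous. A mapping is open if images of open sets are open, and discrete if the preimage of every point consists of isolated points. A curve is a continuous map of an interval; for a family of curves $\Gamma$, $f(\Gamma)=\{f\circ\gamma:\gamma\in\Gamma\}$. $\Gamma(E,F,G)$ is the family of all curves $\gamma:[a,b]\to\overline{\mathbb{R}^n}=\mathbb{R}^n\cup\{\infty\}$ with $\gamma(a)\in E$, $\gamma(b)\in F$ and $\gamma(t)\in G$ for $t\in(a,b)$. A Borel function $\rho:\mathbb{R}^n\to[0,\infty]$ is admissible for $\Gamma$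 if $\int_\gamma\rho\,|dx|\geqslant 1$ for all (locally rectifiable) $\gamma\in\Gamma$. The $p$-modulus ($p\geqslant1$) is $M_p(\Gamma)=\inf_\rho\int_{\mathbb{R}^n}\rho^p\,dm$, the infimum being over all admissible $\rho$. Let $D$ be a domain in $\mathbb{R}^n$, $Q:D\to[0,\infty]$ Lebesgue measurable and $x_0\in D$. A mapping $f$ defined on $D$ is a ring $(p,Q)$-mapping at $x_0$ if for all $0<r_1<r_2<\mathrm{dist}(x_0,\partial D)$, with $S_i=S(x_0,r_i)$ and $A=A(r_1,r_2,x_0)$, $$M_p\big(f(\Gamma(S_1,S_2,A))\big)\leqslant\int_A Q(x)\,\eta^p(|x-x_0|)\,dm(x)$$ for every Lebesgue measurable $\eta:(r_1,r_2)\to[0,\infty]$ with $\int_{r_1}^{r_2}\eta(r)\,dr\geqslant1$. It is a ring $(p,Q)$-mapping (in $D$) if this holds at every point $x_0\in D$. *)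

theory Defs
  imports "HOL-Analysis.Analysis"
begin

text \<open>Real powers on \<open>[0, \<infinity>]\<close>; intended for positive exponents, where \<open>\<infinity>\<close> is sent to \<open>\<infinity>\<close>.\<close>

definition ennreal_powr :: "ennreal \<Rightarrow> real \<Rightarrow> ennreal" where
  "ennreal_powr x a = (if x = \<infinity> then \<infinity> else ennreal (enn2real x powr a))"

definition curve_length :: "(real \<Rightarrow> 'a::metric_space) \<Rightarrow> real \<Rightarrow> real \<Rightarrow> ennreal" where
  "curve_length \<gamma> a b =
     Sup {\<Sum>i<k. ennreal (dist (\<gamma> (t i)) (\<gamma> (t (Suc i)))) | (k::nat) (t::nat \<Rightarrow> real).
            mono_on {..k} t \<and> t 0 = a \<and> t k = b}"

text \<open>Points of \<open>[a, b]\<close> with the same arc length from \<open>a\<close> have the same image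
  under a rectifiable \<open>\<gamma>\<close>, so the value does not depend on the choice.\<close>

definition arc_length_param :: "(real \<Rightarrow> 'a::metric_space) \<Rightarrow> real \<Rightarrow> real \<Rightarrow> real \<Rightarrow> 'a" where
  "arc_length_param \<gamma> a b s = \<gamma> (SOME t. t \<in> {a..b} \<and> curve_length \<gamma> a t = ennreal s)"

definition arc_integral :: "('a::metric_space \<Rightarrow> ennreal) \<Rightarrow> (real \<Rightarrow> 'a) \<Rightarrow> real \<Rightarrow> real \<Rightarrow> ennreal" where
  "arc_integral \<rho> \<gamma> a b =
     (\<integral>\<^sup>+ s \<in> {0..enn2real (curve_length \<gamma> a b)}. \<rho> (arc_length_param \<gamma> a b s) \<partial>lebesgue)"

text \<open>A curve is a pair of its parameter interval and a map, whose values outside the interval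
  are irrelevant.\<close>

type_synonym 'a curve = "real set \<times> (real \<Rightarrow> 'a)"

definition locally_rectifiable :: "'a::metric_space curve \<Rightarrow> bool" where
  "locally_rectifiable c \<longleftrightarrow>
     (\<forall>a b. a \<le> b \<longrightarrow> {a..b} \<subseteq> fst c \<longrightarrow> curve_length (snd c) a b < \<infinity>)"

text \<open>On a non-compact parameter interval the line integral is by definition the supremum over
  compact subcurves; on a compact one the supremum is attained by the whole curve.\<close>

definition line_integral :: "('a::metric_space \<Rightarrow> ennreal) \<Rightarrow> 'a curve \<Rightarrow> ennreal" where
  "line_integral \<rho> c =
     (SUP (a, b) \<in> {(a, b). a \<le> b \<and> {a..b} \<subseteq> fst c}. arc_integral \<rho> (snd c) a b)"

definition admissible :: "('a::euclidean_space \<Rightarrow> ennreal) \<Rightarrow> 'a curve set \<Rightarrow> bool" where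
  "admissible \<rho> \<Gamma> \<longleftrightarrow>
     \<rho> \<in> borel_measurable borel \<and>
     (\<forall>c\<in>\<Gamma>. locally_rectifiable c \<longrightarrow> 1 \<le> line_integral \<rho> c)"

definition modulus :: "real \<Rightarrow> 'a::euclidean_space curve set \<Rightarrow> ennreal" where
  "modulus p \<Gamma> = (INF \<rho> \<in> {\<rho>. admissible \<rho> \<Gamma>}. \<integral>\<^sup>+ x. ennreal_powr (\<rho> x) p \<partial>lebesgue)"

text \<open>For \<open>E\<close>, \<open>F\<close>, \<open>G\<close> not containing the point at infinity, such a curve in the
  extended space never meets that point, so finite-valued curves suffice.\<close>

definition connecting_curves ::
    "'a::euclidean_space set \<Rightarrow> 'a set \<Rightarrow> 'a set \<Rightarrow> 'a curve set" where
  "connecting_curves E F G =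
     {({a..b}, \<gamma>) | a b \<gamma>. a < b \<and> continuous_on {a..b} \<gamma> \<and>
        \<gamma> a \<in> E \<and> \<gamma> b \<in> F \<and> (\<forall>t\<in>{a<..<b}. \<gamma> t \<in> G)}"

definition image_curves :: "('a \<Rightarrow> 'b) \<Rightarrow> 'a curve set \<Rightarrow> 'b curve set" where
  "image_curves f \<Gamma> = (\<lambda>(I, \<gamma>). (I, f \<circ> \<gamma>)) ` \<Gamma>"

definition annulus :: "real \<Rightarrow> real \<Rightarrow> 'a::metric_space \<Rightarrow> 'a set" where
  "annulus r1 r2 x0 = {x. r1 < dist x x0 \<and> dist x x0 < r2}"

text \<open>The distance to the boundary is an infimum in \<open>ereal\<close>, so that it is \<open>\<infinity>\<close> when
  the boundary is empty (\<open>infdist\<close> would give \<open>0\<close>).\<close>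

definition ring_mapping_at ::
    "real \<Rightarrow> ('a::euclidean_space \<Rightarrow> ennreal) \<Rightarrow> 'a set \<Rightarrow> ('a \<Rightarrow> 'a) \<Rightarrow> 'a \<Rightarrow> bool" where
  "ring_mapping_at p Q D f x0 \<longleftrightarrow>
     (\<forall>r1 r2. 0 < r1 \<longrightarrow> r1 < r2 \<longrightarrow> ereal r2 < (INF y\<in>frontier D. ereal (dist x0 y)) \<longrightarrow>
       (\<forall>\<eta> :: real \<Rightarrow> ennreal.
          \<eta> \<in> borel_measurable (lebesgue_on {r1<..<r2}) \<longrightarrow>
          1 \<le> (\<integral>\<^sup>+ r \<in> {r1<..<r2}. \<eta> r \<partial>lebesgue) \<longrightarrow>
          modulus p (image_curves f
              (connecting_curves (sphere x0 r1) (sphere x0 r2) (annulus r1 r2 x0)))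
            \<le> (\<integral>\<^sup>+ x \<in> annulus r1 r2 x0. Q x * ennreal_powr (\<eta> (dist x x0)) p \<partial>lebesgue)))"

definition ring_mapping ::
    "real \<Rightarrow> ('a::euclidean_space \<Rightarrow> ennreal) \<Rightarrow> 'a set \<Rightarrow> ('a \<Rightarrow> 'a) \<Rightarrow> bool" where
  "ring_mapping p Q D f \<longleftrightarrow>
     open D \<and> connected D \<and> D \<noteq> {} \<and>
     Q \<in> borel_measurable (lebesgue_on D) \<and> continuous_on D f \<and>
     (\<forall>x0\<in>D. ring_mapping_at p Q D f x0)"

definition discrete_map_on :: "'a::topological_space set \<Rightarrow> ('a \<Rightarrow> 'b) \<Rightarrow> bool" where
  "discrete_map_on D f \<longleftrightarrow> (\<forall>y. discrete {x\<in>D. f x = y})"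

definition locally_integrable_on :: "('a::euclidean_space \<Rightarrow> ennreal) \<Rightarrow> 'a set \<Rightarrow> bool" where
  "locally_integrable_on Q D \<longleftrightarrow>
     Q \<in> borel_measurable (lebesgue_on D) \<and>
     (\<forall>K. compact K \<longrightarrow> K \<subseteq> D \<longrightarrow> (\<integral>\<^sup>+ x \<in> K. Q x \<partial>lebesgue) < \<infinity>)"

definition lower_mean_at_0 :: "('a::euclidean_space \<Rightarrow> ennreal) \<Rightarrow> ennreal" where
  "lower_mean_at_0 Q =
     Liminf (at_right 0) (\<lambda>\<epsilon>. (\<integral>\<^sup>+ x \<in> ball 0 \<epsilon>. Q x \<partial>lebesgue) /
        ennreal (measure lebesgue (ball (0::'a) 1) * \<epsilon> ^ DIM('a)))"

end

theory Submission
  imports Defs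
begin

text \<open>
  Every ray from the origin lifts through the open discrete map \<open>f\<close>, starting at \<open>0\<close>. Since \<open>f\<close> is
  bounded by \<open>1\<close>, the lift leaves \<open>B(0, R)\<close>, and its part between the spheres of radius \<open>R / 2\<close> and \<open>R\<close>
  is mapped into the ray at distance at least \<open>l = min {|f x| : |x| = R / 2}\<close> from the origin.
  So the image family contains a radial curve in every direction, and because \<open>p < n\<close> this alone
  forces its \<open>p\<close>-modulus to be at least a constant times \<open>l powr (n - p)\<close>. The ring condition
  with \<open>\<eta> = 2 / R\<close> bounds the modulus above by a constant times \<open>R powr (n - p)\<close> times the mean
  of \<open>Q\<close> over \<open>B(0, R)\<close>, which bounds \<open>l / R\<close>.
\<close>

section \<open>Lifting of rays\<close>

text \<open>An open discrete map may branch, so a lift cannot be continued by local inverses and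
  need not be unique. Openness yields only connected links over short pieces of the ray;
  discreteness is what turns a limit of chains of such links into a continuous curve. Nothing is
  known about where the image curves end, only that they start at level \<open>l\<close> or beyond.
  A lower bound for the modulus must therefore survive if they are prolonged to infinity. On a
  single ray the extremal density is a multiple of \<open>\<tau> powr - \<alpha>\<close> with
  \<open>\<alpha> = (n - 1) / (p - 1)\<close>, which is integrable at infinity exactly when
  \<open>p < n\<close>; at \<open>p = n\<close> the bound would decay to zero as the curves get
  longer. Scaling then dictates the exponent \<open>n - p\<close>. The lower limit of the means
  controls \<open>Q\<close> only at certain radii, but these are arbitrarily small. One ring at such
  a scale suffices, because the conclusion is itself about a lower limit.\<close>

lemma compact_pointwise_cluster:
  fixes X :: "nat \<Rightarrow> 'i \<Rightarrow> 'b::topological_space"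
  assumes "compact K" and X: "\<And>m t. X m t \<in> K"
  obtains s G where "G \<noteq> bot" "G \<le> sequentially" "\<And>t. s t \<in> K" "\<And>t. ((\<lambda>m. X m t) \<longlongrightarrow> s t) G"
proof -
  have "compactin (product_topology (\<lambda>i::'i. euclidean::'b topology) UNIV) (PiE UNIV (\<lambda>_. K))"
    using assms(1) by (simp add: compactin_PiE)
  then have "compact (PiE (UNIV::'i set) (\<lambda>_. K))"
    by (simp add: euclidean_product_topology)
  moreover have "filtermap X sequentially \<noteq> bot"
    by (simp add: filtermap_bot_iff)
  moreover have "eventually (\<lambda>x. x \<in> PiE UNIV (\<lambda>_. K)) (filtermap X sequentially)"
    using X by (simp add: eventually_filtermap PiE_UNIV_domain)
  ultimately obtain s where s: "s \<in> PiE UNIV (\<lambda>_. K)"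
      and ne: "inf (nhds s) (filtermap X sequentially) \<noteq> bot"
    unfolding compact_filter by blast
  \<comment> \<open>By Tychonoff the product is compact, but with uncountably many factors a
    sequence in it need not have a convergent subsequence. The filter \<open>G\<close> takes the
    place of one: it selects the large \<open>m\<close> with \<open>X m\<close> near
    \<open>s\<close>, and its properness says exactly that \<open>s\<close> is a cluster
    point.\<close>
  define G where "G = inf (filtercomap X (nhds s)) sequentially"
  have "G \<noteq> bot"
  proof
    assume "G = bot"
    then have "eventually (\<lambda>_. False) G"
      by simp
    then obtain P Q where P: "eventually P (filtercomap X (nhds s))"
      and Q: "eventually Q sequentially" and PQ: "\<And>m. P m \<and> Q m \<Longrightarrow> False"
      unfolding G_def eventually_inf by blast
    obtain R where R: "eventually R (nhds s)" "\<And>m. R (X m) \<Longrightarrow> P m"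
      using P unfolding eventually_filtercomap by blast
    have "eventually (\<lambda>y. \<not> R y) (filtermap X sequentially)"
      unfolding eventually_filtermap using Q by eventually_elim (use R(2) PQ in blast)
    with R(1) have "eventually (\<lambda>_. False) (inf (nhds s) (filtermap X sequentially))"
      unfolding eventually_inf by blast
    with ne show False
      by (simp add: eventually_False)
  qed
  moreover have "G \<le> sequentially"
    unfolding G_def by simp
  moreover have "((\<lambda>m. X m t) \<longlongrightarrow> s t) G" for t
  proof -
    have "filterlim X (nhds s) (filtercomap X (nhds s))"
      by (rule filterlim_filtercomap)
    then have "(X \<longlongrightarrow> s) G"
      unfolding G_def by (rule filterlim_mono) simp_all
    moreover have "open ((\<lambda>x. x t) -` S)" if "open S" for S :: "'b set"
      using that by (intro open_vimage continuous_on_product_coordinates)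
    ultimately show ?thesis
      using topological_tendstoD[of X s G] by (intro topological_tendstoI) fastforce
  qed
  ultimately show thesis
    using that s by (auto simp: PiE_iff)
qed

text \<open>Lightness made uniform: this makes the discrete approximations of a lift asymptotically
  equicontinuous.\<close>

lemma light_map_small_diameter:
  fixes f :: "'a::metric_space \<Rightarrow> 'b::heine_borel"
  assumes K: "compact K" and f: "continuous_on K f"
    and disc: "\<And>y. discrete {x\<in>K. f x = y}" and "0 < e"
  obtains d where "0 < d"
    "\<And>C a b. \<lbrakk>connected C; C \<subseteq> K; a \<in> C; b \<in> C; \<And>x y. x \<in> C \<Longrightarrow> y \<in> C \<Longrightarrow> dist (f x) (f y) \<le> d\<rbrakk>
      \<Longrightarrow> dist a b < e"
proof (rule ccontr)
  assume no: "\<not> thesis"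
  have "\<exists>C a b. connected C \<and> C \<subseteq> K \<and> a \<in> C \<and> b \<in> C \<and>
      (\<forall>x\<in>C. \<forall>y\<in>C. dist (f x) (f y) \<le> 1 / real (Suc n)) \<and> e \<le> dist a b" for n
  proof (rule ccontr)
    assume neg: "\<not> ?thesis"
    have thesis
    proof (rule that)
      show "0 < 1 / real (Suc n)"
        by simp
      fix C a b
      assume "connected C" "C \<subseteq> K" "a \<in> C" "b \<in> C" "\<And>x y. x \<in> C \<Longrightarrow> y \<in> C \<Longrightarrow> dist (f x) (f y) \<le> 1 / real (Suc n)"
      then show "dist a b < e"
        using neg by (meson not_le)
    qed
    with no show False ..
  qed
  then obtain C a b where C: "\<And>n. connected (C n)" "\<And>n. C n \<subseteq> K" "\<And>n. a n \<in> C n" "\<And>n. b n \<in> C n"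
      "\<And>n x y. x \<in> C n \<Longrightarrow> y \<in> C n \<Longrightarrow> dist (f x) (f y) \<le> 1 / real (Suc n)" "\<And>n. e \<le> dist (a n) (b n)"
    by metis
  have "\<forall>n. a n \<in> K"
    using C by blast
  with K obtain l r where l: "l \<in> K" and r: "strict_mono r" and ar: "(a \<circ> r) \<longlonglongrightarrow> l"
    unfolding compact_def by blast
  have "\<forall>\<^sub>F x in at l. x \<notin> {x\<in>K. f x = f l}"
    using disc l unfolding discrete_altdef by blast
  then obtain e0 where e0: "0 < e0" "\<And>x. \<lbrakk>x \<noteq> l; dist x l < e0; x \<in> K\<rbrakk> \<Longrightarrow> f x \<noteq> f l"
    unfolding eventually_at by auto
  \<comment> \<open>Since \<open>q < e0\<close>, the sphere of radius \<open>q\<close> around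
    \<open>l\<close> misses the fibre of \<open>l\<close>, so \<open>f\<close> keeps a positive
    distance from \<open>f l\<close> on it. Since \<open>2 * q < e\<close>, a connected set
    containing two points at distance \<open>e\<close>, one of them within \<open>q\<close> of
    \<open>l\<close>, must cross this sphere.\<close>
  define q where "q = min e0 e / 3"
  have q: "0 < q" "q < e0" "2 * q < e"
    using e0(1) \<open>0 < e\<close> by (auto simp: q_def min_def)
  have cS: "compact (K \<inter> sphere l q)"
    using K unfolding sphere_def by (intro compact_Int_closed closed_Collect_eq continuous_intros)
  then have "closed (f ` (K \<inter> sphere l q))"
    by (meson compact_continuous_image compact_imp_closed continuous_on_subset f inf_le1)
  moreover have "f l \<notin> f ` (K \<inter> sphere l q)"
    using e0(2) q by (force simp: dist_commute)
  ultimately obtain d where d: "0 < d" "\<And>x. x \<in> K \<Longrightarrow> dist l x = q \<Longrightarrow> d \<le> dist (f l) (f x)"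
    using separate_point_closed[of "f ` (K \<inter> sphere l q)" "f l"] by auto
  have "(\<lambda>n. f (a (r n))) \<longlonglongrightarrow> f l"
    using l \<open>\<forall>n. a n \<in> K\<close> by (intro continuous_on_tendsto_compose[OF f ar[unfolded comp_def]]) simp_all
  then have "\<forall>\<^sub>F n in sequentially. dist (f (a (r n))) (f l) < d / 2"
    by (rule tendstoD) (use d(1) in simp)
  moreover have "\<forall>\<^sub>F n in sequentially. dist (a (r n)) l < q"
    using ar q(1) by (simp add: tendsto_iff)
  moreover have "\<forall>\<^sub>F n in sequentially. 1 / real (Suc n) < d / 2"
    using d(1) order_tendstoD(2)[OF LIMSEQ_inverse_real_of_nat, of "d / 2"] by (simp add: field_simps)
  ultimately have "\<forall>\<^sub>F n in sequentially. False"
  proof eventually_elim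
    case (elim n)
    let ?D = "C (r n)"
    have "connected (dist l ` ?D)"
      by (intro connected_continuous_image C continuous_intros)
    moreover have "dist l (a (r n)) \<in> dist l ` ?D" "dist l (b (r n)) \<in> dist l ` ?D"
      using C by blast+
    moreover have "q \<le> dist l (b (r n))"
      using C(6)[of "r n"] elim(2) q(3) dist_triangle[of "a (r n)" "b (r n)" l] by (simp add: dist_commute)
    ultimately have "q \<in> dist l ` ?D"
      using elim(2) connected_contains_Icc[of "dist l ` ?D"] by (fastforce simp: dist_commute)
    then obtain c where c: "c \<in> ?D" "dist l c = q"
      by auto
    have "dist (f (a (r n))) (f c) \<le> 1 / real (Suc (r n))"
      using C c by blast
    also have "\<dots> \<le> 1 / real (Suc n)"
      using seq_suble[OF r, of n] by (simp add: frac_le)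
    finally have "dist (f l) (f c) < d"
      using elim dist_triangle[of "f l" "f c" "f (a (r n))"] by (simp add: dist_commute)
    moreover have "d \<le> dist (f l) (f c)"
      using d(2) c C by blast
    ultimately show False
      by simp
  qed
  then show False
    by simp
qed

text \<open>For a unit vector \<open>u\<close> the equation says that \<open>f x\<close> lies on the
  closed ray through \<open>u\<close>. In this form it is a closed condition that passes to limits,
  and the zeros of \<open>f\<close> satisfy it for every \<open>u\<close>.\<close>

definition ray_preimage :: "'a set \<Rightarrow> ('a \<Rightarrow> 'b::real_normed_vector) \<Rightarrow> 'b \<Rightarrow> 'a set" where
  "ray_preimage K f u = {x\<in>K. f x = norm (f x) *\<^sub>R u}"

text \<open>If the component of \<open>x\<close> met neither the level \<open>norm (f x) + h\<close> nor the boundary of \<open>K\<close>, it would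
  lie in a clopen set avoiding both, on which \<open>norm \<circ> f\<close> attains a maximum, against openness.\<close>

lemma ray_preimage_step:
  fixes f :: "'a::euclidean_space \<Rightarrow> 'b::real_normed_vector"
  assumes K: "compact K" and f: "continuous_on K f"
    and op: "\<And>U. open U \<Longrightarrow> U \<subseteq> K \<Longrightarrow> open (f ` U)"
    and u: "norm u = 1" and x: "x \<in> ray_preimage K f u" and h: "0 < h"
  obtains z C where "connected C" "C \<subseteq> ray_preimage K f u" "x \<in> C" "z \<in> C"
    "\<And>y. y \<in> C \<Longrightarrow> norm (f x) \<le> norm (f y) \<and> norm (f y) \<le> norm (f x) + h"
    "norm (f z) = norm (f x) + h \<or> z \<notin> interior K"
proof -
  define Y where "Y = {y\<in>ray_preimage K f u. norm (f y) \<in> {norm (f x)..norm (f x) + h}}"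
  define T where "T = {y\<in>Y. norm (f y) = norm (f x) + h \<or> y \<notin> interior K}"
  have nf: "continuous_on K (\<lambda>y. norm (f y))"
    using f by (intro continuous_intros)
  have "continuous_on K (\<lambda>y. (f y - norm (f y) *\<^sub>R u, norm (f y)))"
    using f by (intro continuous_intros)
  from continuous_closed_preimage[OF this compact_imp_closed[OF K],
      of "{0} \<times> {norm (f x)..norm (f x) + h}"]
  have "closed (K \<inter> (\<lambda>y. (f y - norm (f y) *\<^sub>R u, norm (f y))) -` ({0} \<times> {norm (f x)..norm (f x) + h}))"
    by (simp add: closed_Times)
  moreover have "K \<inter> (\<lambda>y. (f y - norm (f y) *\<^sub>R u, norm (f y))) -` ({0} \<times> {norm (f x)..norm (f x) + h}) = Y"
    unfolding Y_def ray_preimage_def by auto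
  ultimately have "closed Y"
    by simp
  moreover have YK: "Y \<subseteq> K"
    unfolding Y_def ray_preimage_def by auto
  ultimately have cY: "compact Y"
    using K compact_Int_closed[of K Y] by (simp add: Int_absorb1)
  have "closed (Y \<inter> (\<lambda>y. norm (f y)) -` {norm (f x) + h})"
    by (rule continuous_closed_preimage[OF continuous_on_subset[OF nf YK] \<open>closed Y\<close>]) simp
  moreover have "T = (Y \<inter> (\<lambda>y. norm (f y)) -` {norm (f x) + h}) \<union> (Y - interior K)"
    unfolding T_def by auto
  ultimately have cT: "closed T"
    using \<open>closed Y\<close> by (simp add: closed_Diff closed_Un)
  have xY: "x \<in> Y"
    using x h unfolding Y_def by simp
  define C where "C = connected_component_set Y x"
  have CY: "C \<subseteq> Y" "connected C" "x \<in> C" "C \<in> components Y"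
    using xY by (auto simp: C_def connected_component_subset componentsI)
  have "C \<inter> T \<noteq> {}"
  proof
    assume "C \<inter> T = {}"
    moreover have "compact C"
      using compact_components[OF cY CY(4)] .
    \<comment> \<open>Sura-Bura: a component of a compact set has arbitrarily small clopen
      neighbourhoods. \<open>C\<close> itself need not be open in \<open>Y\<close>, whereas the
      maximum argument has to recognize nearby points of \<open>Y\<close> as members of the
      set.\<close>
    ultimately obtain N where N: "openin (top_of_set Y) N" "compact N" "C \<subseteq> N" "N \<subseteq> - T"
      using Sura_Bura_clopen_subset[of Y C "- T"] CY cY cT
      by (metis compact_imp_closed closed_imp_locally_compact disjoint_eq_subset_Compl open_Compl)
    obtain V where V: "open V" "N = Y \<inter> V"
      using N(1) by (auto simp: openin_open)
    have "N \<noteq> {}"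
      using N CY by blast
    moreover have "continuous_on N (\<lambda>y. norm (f y))"
      using nf V(2) YK continuous_on_subset by blast
    ultimately obtain z where z: "z \<in> N" "\<And>y. y \<in> N \<Longrightarrow> norm (f y) \<le> norm (f z)"
      using continuous_attains_sup[OF N(2)] by blast
    have zY: "z \<in> Y" "z \<notin> T"
      using z N V by auto
    then have zi: "z \<in> interior K" "norm (f z) \<noteq> norm (f x) + h"
      by (auto simp: T_def)
    have fz: "norm (f x) \<le> norm (f z)" "norm (f z) < norm (f x) + h" "f z = norm (f z) *\<^sub>R u"
      using zY(1) zi(2) by (auto simp: Y_def ray_preimage_def)
    have "open (f ` (V \<inter> interior K))"
      using V(1) interior_subset[of K] by (intro op) auto
    moreover have "f z \<in> f ` (V \<inter> interior K)"
      using z(1) V zi by auto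
    ultimately obtain e where e: "0 < e" "ball (f z) e \<subseteq> f ` (V \<inter> interior K)"
      unfolding open_contains_ball by blast
    \<comment> \<open>A step of length \<open>k\<close> outward along the ray stays in the image of
      \<open>V \<inter> interior K\<close> and does not pass the top level. Its preimage in
      \<open>V\<close> thus belongs to \<open>N\<close> and has a larger norm of the image than the
      maximum point \<open>z\<close>.\<close>
    define k where "k = min (e / 2) (norm (f x) + h - norm (f z))"
    have k: "0 < k" "k < e" "norm (f z) + k \<le> norm (f x) + h"
      using e(1) fz(2) by (auto simp: k_def min_def)
    have "f z - (norm (f z) + k) *\<^sub>R u = - k *\<^sub>R u"
      by (subst fz(3)) (simp add: algebra_simps)
    then have "(norm (f z) + k) *\<^sub>R u \<in> ball (f z) e"
      using k u by (simp add: dist_norm)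
    then obtain y where y: "y \<in> V" "y \<in> interior K" "f y = (norm (f z) + k) *\<^sub>R u"
      using e(2) by force
    have ny: "norm (f y) = norm (f z) + k"
      using y(3) u k by simp
    then have "y \<in> Y"
      using y(2,3) ny u fz(1) k interior_subset[of K] unfolding Y_def ray_preimage_def by (simp add: subset_iff)
    then have "y \<in> N"
      using V y by auto
    with z(2) ny k show False
      by fastforce
  qed
  then obtain z where "z \<in> C" "z \<in> T"
    by blast
  then show thesis
    using CY by (intro that[of C z]) (auto simp: Y_def T_def)
qed

lemma ray_preimage_chain:
  fixes f :: "'a::euclidean_space \<Rightarrow> 'b::real_normed_vector"
  assumes K: "compact K" and f: "continuous_on K f"
    and op: "\<And>U. open U \<Longrightarrow> U \<subseteq> K \<Longrightarrow> open (f ` U)"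
    and u: "norm u = 1" and x0: "x0 \<in> K" "f x0 = 0" and h: "0 < h"
  obtains c C where "c 0 = x0" "\<And>i. connected (C i)" "\<And>i. C i \<subseteq> ray_preimage K f u"
    "\<And>i. c i \<in> C i" "\<And>i. c (Suc i) \<in> C i"
    "\<And>i x y. x \<in> C i \<Longrightarrow> y \<in> C i \<Longrightarrow> dist (f x) (f y) \<le> h"
    "\<And>i. norm (f (c i)) \<le> norm (f (c (Suc i)))"
    "\<And>i. c i \<in> interior K \<Longrightarrow> norm (f (c i)) = real i * h"
proof -
  let ?X = "ray_preimage K f u"
  \<comment> \<open>The last conjunct forbids a return to the interior, so a chain point there has
    all its predecessors there, and every step so far has gained exactly \<open>h\<close>. Outside
    the interior a point may simply be repeated; the chain is thus defined for all indices.\<close>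
  define good where "good x z D \<longleftrightarrow> connected D \<and> D \<subseteq> ?X \<and> x \<in> D \<and> z \<in> D \<and>
    (\<forall>y\<in>D. norm (f x) \<le> norm (f y) \<and> norm (f y) \<le> norm (f x) + h) \<and>
    (z \<in> interior K \<longrightarrow> x \<in> interior K \<and> norm (f z) = norm (f x) + h)" for x z D
  have "\<exists>z D. good x z D" if "x \<in> ?X" for x
  proof (cases "x \<in> interior K")
    case True
    show ?thesis
      by (rule ray_preimage_step[OF K f op u that h]) (use True in \<open>auto simp: good_def\<close>)
  next
    case False
    then have "good x x {x}"
      using that h by (auto simp: good_def)
    then show ?thesis
      by blast
  qed
  then obtain z D where zD: "\<And>x. x \<in> ?X \<Longrightarrow> good x (z x) (D x)"
    by metis
  define c where "c i = (z ^^ i) x0" for i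
  have cX: "c i \<in> ?X" for i
  proof (induction i)
    case 0
    then show ?case
      using x0 by (simp add: c_def ray_preimage_def)
  next
    case (Suc i)
    then show ?case
      using zD[OF Suc] unfolding good_def c_def by auto
  qed
  have good: "good (c i) (c (Suc i)) (D (c i))" for i
    using zD[OF cX[of i]] by (simp add: c_def)
  have dist: "dist (f x) (f y) \<le> h" if "x \<in> D (c i)" "y \<in> D (c i)" for i x y
  proof -
    have "x \<in> ?X" "y \<in> ?X"
      using good[of i] that by (auto simp: good_def)
    then have "f x - f y = (norm (f x) - norm (f y)) *\<^sub>R u"
      by (simp add: ray_preimage_def algebra_simps)
    then have "dist (f x) (f y) = \<bar>norm (f x) - norm (f y)\<bar>"
      using u by (simp add: dist_norm)
    also have "\<dots> \<le> h"
      using good[of i] that unfolding good_def by (smt (verit))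
    finally show ?thesis .
  qed
  have int: "norm (f (c i)) = real i * h" if "c i \<in> interior K" for i
    using that
  proof (induction i)
    case 0
    then show ?case
      using x0 by (simp add: c_def)
  next
    case (Suc i)
    then have "c i \<in> interior K" "norm (f (c (Suc i))) = norm (f (c i)) + h"
      using good[of i] by (auto simp: good_def)
    then show ?case
      using Suc by (simp add: algebra_simps)
  qed
  show thesis
  proof (rule that[of c "\<lambda>i. D (c i)"])
    show "c 0 = x0"
      by (simp add: c_def)
  qed (use good dist int in \<open>auto simp: good_def\<close>)
qed


text \<open>Instead of a lift of the ray parametrized by arc length one gets, with less effort, a lift of
  some monotone reparametrization: a pointwise cluster point of chains of mesh \<open>1 / Suc m\<close>.\<close>

lemma ray_lift:
  fixes f :: "'a::euclidean_space \<Rightarrow> 'b::euclidean_space"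
  assumes K: "compact K" and f: "continuous_on K f"
    and disc: "\<And>y. discrete {x\<in>K. f x = y}"
    and op: "\<And>U. open U \<Longrightarrow> U \<subseteq> K \<Longrightarrow> open (f ` U)"
    and bd: "\<And>x. x \<in> K \<Longrightarrow> norm (f x) < 1"
    and u: "norm u = 1" and x0: "x0 \<in> K" "f x0 = 0"
  obtains s where "continuous_on {0..1::real} s" "s \<in> {0..1} \<rightarrow> K" "s 0 = x0" "s 1 \<notin> interior K"
    "mono_on {0..1} (\<lambda>t. norm (f (s t)))" "\<And>t. t \<in> {0..1} \<Longrightarrow> f (s t) = norm (f (s t)) *\<^sub>R u"
proof -
  define h where "h m = 1 / real (Suc m)" for m
  have "\<exists>c C. c 0 = x0 \<and> (\<forall>i. connected (C i) \<and> C i \<subseteq> ray_preimage K f u \<and> c i \<in> C i \<and> c (Suc i) \<in> C i \<and>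
      (\<forall>x\<in>C i. \<forall>y\<in>C i. dist (f x) (f y) \<le> h m) \<and> norm (f (c i)) \<le> norm (f (c (Suc i))) \<and>
      (c i \<in> interior K \<longrightarrow> norm (f (c i)) = real i * h m))" for m
    by (rule ray_preimage_chain[OF K f op u x0, of "h m"]) (auto simp: h_def, blast)
  then obtain c C where c0: "\<And>m. c m 0 = x0" and C: "\<And>m i. connected (C m i)"
      "\<And>m i. C m i \<subseteq> ray_preimage K f u" "\<And>m i. c m i \<in> C m i" "\<And>m i. c m (Suc i) \<in> C m i"
      "\<And>m i x y. x \<in> C m i \<Longrightarrow> y \<in> C m i \<Longrightarrow> dist (f x) (f y) \<le> h m"
      "\<And>m i. norm (f (c m i)) \<le> norm (f (c m (Suc i)))"
      "\<And>m i. c m i \<in> interior K \<Longrightarrow> norm (f (c m i)) = real i * h m"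
    by metis
  have cX: "c m i \<in> ray_preimage K f u" for m i
    using C(2,3) by blast
  then have cK: "c m i \<in> K" for m i
    unfolding ray_preimage_def by blast
  \<comment> \<open>Consecutive links share a chain point, so their union is connected, and the
    diameter of its image grows at most linearly in the number of links. This is the kind of set to
    which uniform lightness applies.\<close>
  have join: "\<exists>D. connected D \<and> D \<subseteq> K \<and> c m i \<in> D \<and> c m (i + k) \<in> D \<and>
      (\<forall>x\<in>D. \<forall>y\<in>D. dist (f x) (f y) \<le> real k * h m)" for m i k
  proof (induction k)
    case 0
    show ?case
      using cK by (intro exI[of _ "{c m i}"]) auto
  next
    case (Suc k)
    then obtain D where D: "connected D" "D \<subseteq> K" "c m i \<in> D" "c m (i + k) \<in> D"
        "\<And>x y. x \<in> D \<Longrightarrow> y \<in> D \<Longrightarrow> dist (f x) (f y) \<le> real k * h m"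
      by blast
    let ?E = "C m (i + k)"
    have h0: "0 \<le> h m"
      by (simp add: h_def)
    have mix: "dist (f x) (f y) \<le> real (Suc k) * h m" if "x \<in> D" "y \<in> ?E" for x y
    proof -
      have "dist (f x) (f (c m (i + k))) \<le> real k * h m" "dist (f (c m (i + k))) (f y) \<le> h m"
        using D that C(3,5) by blast+
      then show ?thesis
        using dist_triangle[of "f x" "f y" "f (c m (i + k))"] by (simp add: algebra_simps)
    qed
    show ?case
    proof (intro exI[of _ "D \<union> ?E"] conjI ballI)
      show "connected (D \<union> ?E)"
        using D C by (intro connected_Un) auto
      show "D \<union> ?E \<subseteq> K"
        using D C(2)[of m "i + k"] by (auto simp: ray_preimage_def)
      show "dist (f x) (f y) \<le> real (Suc k) * h m" if "x \<in> D \<union> ?E" "y \<in> D \<union> ?E" for x y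
      proof -
        have "dist (f x) (f y) \<le> real (Suc k) * h m" if "x \<in> D" "y \<in> D"
          using D(5)[OF that] h0 by (simp add: algebra_simps)
        moreover have "dist (f x) (f y) \<le> real (Suc k) * h m" if "x \<in> ?E" "y \<in> ?E"
          using C(5)[OF that] h0 by (simp add: algebra_simps add_increasing2)
        ultimately show ?thesis
          using that mix[of x y] mix[of y x] by (auto simp: dist_commute)
      qed
    qed (use D C(4)[of m "i + k"] in auto)
  qed
  \<comment> \<open>While the chain is in the interior, time \<open>t\<close> is the value of
    \<open>norm \<circ> f\<close> up to the mesh. At time \<open>1\<close> that value would be
    exactly \<open>1\<close>, against \<open>bd\<close>, so by then the chain has left the interior.
    From its exit on the level may stall, hence mere monotonicity.\<close>
  define X where "X m t = c m (nat \<lfloor>t * real (Suc m)\<rfloor>)" for m t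
  have XK: "X m t \<in> K" for m t
    by (simp add: X_def cK)
  obtain s G where G: "G \<noteq> bot" "G \<le> sequentially" and sK: "\<And>t. s t \<in> K"
      and lim: "\<And>t. ((\<lambda>m. X m t) \<longlongrightarrow> s t) G"
    by (rule compact_pointwise_cluster[of K X, OF K XK]) (rule that)
  have flim: "((\<lambda>m. f (X m t)) \<longlongrightarrow> f (s t)) G" for t
    by (rule continuous_on_tendsto_compose[OF f lim sK]) (simp add: X_def cK)
  have nlim: "((\<lambda>m. norm (f (X m t))) \<longlongrightarrow> norm (f (s t))) G" for t
    by (intro tendsto_norm flim)
  show thesis
  proof
    show "s \<in> {0..1} \<rightarrow> K"
      using sK by blast
    show "s 0 = x0"
      using lim[of 0] G(1) by (simp add: X_def c0 tendsto_const_iff)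
    have "X m 1 \<notin> interior K" for m
    proof
      assume "X m 1 \<in> interior K"
      moreover have "X m 1 = c m (Suc m)"
        unfolding X_def by (metis floor_of_nat mult_1 nat_int)
      ultimately have "norm (f (c m (Suc m))) = 1"
        using C(7)[of m "Suc m"] by (simp add: h_def)
      then show False
        using bd[OF cK[of m "Suc m"]] by simp
    qed
    then show "s 1 \<notin> interior K"
      using Lim_in_closed_set[of "- interior K" "\<lambda>m. X m 1" G "s 1"] G(1) lim[of 1]
      by (simp add: closed_Compl)
    show "mono_on {0..1} (\<lambda>t. norm (f (s t)))"
    proof (rule mono_onI)
      fix t t' :: real
      assume t: "t \<in> {0..1}" "t' \<in> {0..1}" "t \<le> t'"
      have "norm (f (X m t)) \<le> norm (f (X m t'))" for m
        unfolding X_def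
      proof (rule lift_Suc_mono_le[of "\<lambda>i. norm (f (c m i))", OF C(6)])
        show "nat \<lfloor>t * real (Suc m)\<rfloor> \<le> nat \<lfloor>t' * real (Suc m)\<rfloor>"
          using t by (intro nat_mono floor_mono mult_right_mono) auto
      qed
      then show "norm (f (s t)) \<le> norm (f (s t'))"
        by (intro tendsto_le[OF G(1) nlim nlim] always_eventually allI)
    qed
    show "f (s t) = norm (f (s t)) *\<^sub>R u" if "t \<in> {0..1}" for t
    proof -
      have "f (X m t) = norm (f (X m t)) *\<^sub>R u" for m
        using cX unfolding X_def ray_preimage_def by blast
      then have "((\<lambda>m. f (X m t)) \<longlongrightarrow> norm (f (s t)) *\<^sub>R u) G"
        using tendsto_scaleR[OF nlim[of t] tendsto_const[of u]] by simp
      then show ?thesis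
        using tendsto_unique[OF G(1) flim] by blast
    qed
    show "continuous_on {0..1} s"
      unfolding continuous_on_iff
    proof (intro ballI allI impI)
      fix t e :: real
      assume t: "t \<in> {0..1}" and "0 < e"
      obtain d where d: "0 < d" "\<And>D a b. \<lbrakk>connected D; D \<subseteq> K; a \<in> D; b \<in> D;
          \<And>x y. x \<in> D \<Longrightarrow> y \<in> D \<Longrightarrow> dist (f x) (f y) \<le> d\<rbrakk> \<Longrightarrow> dist a b < e / 2"
        by (rule light_map_small_diameter[OF K f disc, of "e / 2"]) (use \<open>0 < e\<close> in auto)
      have evh: "\<forall>\<^sub>F m in G. h m < d / 2"
        using d(1) order_tendstoD(2)[OF LIMSEQ_inverse_real_of_nat, of "d / 2"]
        by (intro filter_leD[OF G(2)]) (simp add: h_def field_simps)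
      \<comment> \<open>The step functions \<open>X m\<close> jump, so continuity can only appear in
        the limit. Rounding adds at most one link to the \<open>(b - a) * real (Suc m)\<close>
        expected between the two times, so the image diameter is at most \<open>b - a + h m\<close>;
        each summand gets one half of \<open>d\<close>.\<close>
      have ord: "dist (s a) (s b) \<le> e / 2" if ab: "0 \<le> a" "a \<le> b" "b - a < d / 2" for a b
      proof (rule tendsto_upperbound[OF tendsto_dist[OF lim lim] _ G(1)])
        show "\<forall>\<^sub>F m in G. dist (X m a) (X m b) \<le> e / 2"
          using evh
        proof eventually_elim
          case (elim m)
          let ?i = "nat \<lfloor>a * real (Suc m)\<rfloor>" and ?j = "nat \<lfloor>b * real (Suc m)\<rfloor>"
          have ij: "?i \<le> ?j"
            using ab by (intro nat_mono floor_mono mult_right_mono) auto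
          obtain D where D: "connected D" "D \<subseteq> K" "c m ?i \<in> D" "c m ?j \<in> D"
              "\<And>x y. x \<in> D \<Longrightarrow> y \<in> D \<Longrightarrow> dist (f x) (f y) \<le> real (?j - ?i) * h m"
            using join[of m ?i "?j - ?i"] ij by auto
          have "real ?i = of_int \<lfloor>a * real (Suc m)\<rfloor>" "real ?j = of_int \<lfloor>b * real (Suc m)\<rfloor>"
            using ab by simp_all
          then have "real (?j - ?i) \<le> (b - a) * real (Suc m) + 1"
            using of_int_floor_le[of "b * real (Suc m)"] real_of_int_floor_add_one_gt[of "a * real (Suc m)"]
            unfolding of_nat_diff[OF ij] left_diff_distrib by linarith
          then have "real (?j - ?i) * h m \<le> ((b - a) * real (Suc m) + 1) * h m"
            by (intro mult_right_mono) (auto simp: h_def)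
          also have "\<dots> = b - a + h m"
            by (simp add: h_def field_simps)
          also have "\<dots> \<le> d"
            using elim ab by simp
          finally have "dist (c m ?i) (c m ?j) < e / 2"
            using D by (intro d(2)[of D]) (auto intro: order_trans)
          then show ?case
            by (simp add: X_def)
        qed
      qed
      show "\<exists>d>0. \<forall>t'\<in>{0..1}. dist t' t < d \<longrightarrow> dist (s t') (s t) < e"
      proof (intro exI[of _ "d / 2"] conjI ballI impI)
        fix t'
        assume "t' \<in> {0..1}" "dist t' t < d / 2"
        then have "dist (s t') (s t) \<le> e / 2"
          using ord[of t t'] ord[of t' t] t by (cases "t \<le> t'") (auto simp: dist_real_def dist_commute)
        then show "dist (s t') (s t) < e"
          using \<open>0 < e\<close> by simp
      qed (use d in simp)
    qed
  qed
qed

section \<open>Modulus of families of radial curves\<close>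

text \<open>Distances along a monotone radial curve are increments of \<open>\<phi>\<close>, so
  every partition sum telescopes to the same value and the supremum is over a singleton.\<close>

lemma curve_length_radial:
  assumes "a \<le> b" and \<phi>: "mono_on {a..b} \<phi>" and \<gamma>: "\<And>t. t \<in> {a..b} \<Longrightarrow> \<gamma> t = \<phi> t *\<^sub>R u"
    and u: "norm (u::'a::real_normed_vector) = 1"
  shows "curve_length \<gamma> a b = ennreal (\<phi> b - \<phi> a)"
proof -
  have sum_eq: "(\<Sum>i<k. ennreal (dist (\<gamma> (t i)) (\<gamma> (t (Suc i))))) = ennreal (\<phi> b - \<phi> a)"
    if t: "mono_on {..k} t" "t 0 = a" "t k = b" for k and t :: "nat \<Rightarrow> real"
  proof -
    have mem: "t i \<in> {a..b}" if "i \<le> k" for i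
      using mono_onD[OF t(1), of 0 i] mono_onD[OF t(1), of i k] t(2,3) that by simp
    have "dist (\<gamma> (t i)) (\<gamma> (t (Suc i))) = \<phi> (t (Suc i)) - \<phi> (t i)" if "i < k" for i
    proof -
      have "\<phi> (t i) \<le> \<phi> (t (Suc i))"
        using that by (intro mono_onD[OF \<phi>] mem mono_onD[OF t(1)]) auto
      moreover have "\<gamma> (t i) = \<phi> (t i) *\<^sub>R u" "\<gamma> (t (Suc i)) = \<phi> (t (Suc i)) *\<^sub>R u"
        using that by (auto intro!: \<gamma> mem)
      ultimately show ?thesis
        using u by (simp add: dist_norm flip: scaleR_diff_left)
    qed
    then have "(\<Sum>i<k. dist (\<gamma> (t i)) (\<gamma> (t (Suc i)))) = (\<Sum>i<k. \<phi> (t (Suc i)) - \<phi> (t i))"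
      by simp
    then have "(\<Sum>i<k. ennreal (dist (\<gamma> (t i)) (\<gamma> (t (Suc i))))) = ennreal (\<Sum>i<k. \<phi> (t (Suc i)) - \<phi> (t i))"
      by (simp add: sum_ennreal)
    then show ?thesis
      using t sum_lessThan_telescope[of "\<lambda>i. \<phi> (t i)" k] by simp
  qed
  have "\<exists>(k::nat) t. mono_on {..k} t \<and> t 0 = a \<and> t k = b"
    using \<open>a \<le> b\<close> by (intro exI[of _ 1] exI[of _ "\<lambda>i. if i = 0 then a else b"]) (auto simp: mono_on_def)
  then obtain k and t :: "nat \<Rightarrow> real" where kt: "mono_on {..k} t" "t 0 = a" "t k = b"
    by blast
  have "{\<Sum>i<k. ennreal (dist (\<gamma> (t i)) (\<gamma> (t (Suc i)))) | (k::nat) (t::nat \<Rightarrow> real).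
      mono_on {..k} t \<and> t 0 = a \<and> t k = b} = {ennreal (\<phi> b - \<phi> a)}"
    using sum_eq sum_eq[OF kt] kt by (auto intro!: exI[of _ k] exI[of _ t])
  then show ?thesis
    by (simp add: curve_length_def)
qed

text \<open>Where \<open>\<phi>\<close> is constant, several parameters have the same arc length,
  but \<open>\<gamma>\<close> depends on the parameter only through \<open>\<phi>\<close>. Whatever
  parameter is chosen, arc length \<open>s\<close> leads to the point at level
  \<open>\<phi> a + s\<close>; continuity of \<open>\<phi>\<close> ensures that this level is
  attained.\<close>

lemma arc_integral_radial:
  fixes \<rho> :: "'a::euclidean_space \<Rightarrow> ennreal"
  assumes "a \<le> b" and \<phi>: "mono_on {a..b} \<phi>" "continuous_on {a..b} \<phi>"
    and \<gamma>: "\<And>t. t \<in> {a..b} \<Longrightarrow> \<gamma> t = \<phi> t *\<^sub>R u" and u: "norm u = 1"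
    and \<rho>[measurable]: "\<rho> \<in> borel_measurable borel"
  shows "arc_integral \<rho> \<gamma> a b = (\<integral>\<^sup>+ \<tau> \<in> {\<phi> a..\<phi> b}. \<rho> (\<tau> *\<^sub>R u) \<partial>lborel)"
proof -
  have le: "\<phi> a \<le> \<phi> b"
    using \<open>a \<le> b\<close> by (intro mono_onD[OF \<phi>(1)]) auto
  have par: "arc_length_param \<gamma> a b s = (\<phi> a + s) *\<^sub>R u" if s: "s \<in> {0..\<phi> b - \<phi> a}" for s
  proof -
    have len: "curve_length \<gamma> a t = ennreal s \<longleftrightarrow> \<phi> t = \<phi> a + s" if "t \<in> {a..b}" for t
    proof -
      have "curve_length \<gamma> a t = ennreal (\<phi> t - \<phi> a)"
        using that \<gamma> by (intro curve_length_radial[OF _ mono_on_subset[OF \<phi>(1)] _ u]) auto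
      moreover have "\<phi> a \<le> \<phi> t"
        using that by (intro mono_onD[OF \<phi>(1)]) auto
      ultimately show ?thesis
        using s by auto
    qed
    have "\<exists>t\<ge>a. t \<le> b \<and> \<phi> t = \<phi> a + s"
      using s \<open>a \<le> b\<close> by (intro IVT' \<phi>(2)) auto
    then have "\<exists>t. t \<in> {a..b} \<and> curve_length \<gamma> a t = ennreal s"
      using len by auto
    from someI_ex[OF this] show ?thesis
      using len \<gamma> unfolding arc_length_param_def by auto
  qed
  have "enn2real (curve_length \<gamma> a b) = \<phi> b - \<phi> a"
    using curve_length_radial[OF \<open>a \<le> b\<close> \<phi>(1) \<gamma> u] le by simp
  then have "arc_integral \<rho> \<gamma> a b =
      (\<integral>\<^sup>+ s. \<rho> (arc_length_param \<gamma> a b s) * indicator {0..\<phi> b - \<phi> a} s \<partial>lborel)"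
    by (simp add: arc_integral_def nn_integral_completion)
  also have "\<dots> = (\<integral>\<^sup>+ s. \<rho> ((\<phi> a + s) *\<^sub>R u) * indicator {0..\<phi> b - \<phi> a} s \<partial>lborel)"
    by (intro nn_integral_cong) (auto simp: indicator_def par)
  also have "\<dots> = (\<integral>\<^sup>+ s. \<rho> ((\<phi> a + 1 * s) *\<^sub>R u) * indicator {\<phi> a..\<phi> b} (\<phi> a + 1 * s) \<partial>lborel)"
    by (intro nn_integral_cong) (auto simp: indicator_def)
  also have "\<dots> = (\<integral>\<^sup>+ \<tau> \<in> {\<phi> a..\<phi> b}. \<rho> (\<tau> *\<^sub>R u) \<partial>lborel)"
    by (subst nn_integral_real_affine[where c = 1 and t = "\<phi> a"]) auto
  finally show ?thesis .
qed

text \<open>The bound deliberately forgets where the curve ends, since for lifted rays only the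
  starting level can be controlled.\<close>

lemma line_integral_radial_le:
  fixes \<rho> :: "'a::euclidean_space \<Rightarrow> ennreal"
  assumes \<phi>: "mono_on {a..b} \<phi>" "continuous_on {a..b} \<phi>"
    and \<gamma>: "\<And>t. t \<in> {a..b} \<Longrightarrow> \<gamma> t = \<phi> t *\<^sub>R u" and u: "norm u = 1"
    and \<rho>: "\<rho> \<in> borel_measurable borel"
  shows "line_integral \<rho> ({a..b}, \<gamma>) \<le> (\<integral>\<^sup>+ \<tau> \<in> {\<phi> a..}. \<rho> (\<tau> *\<^sub>R u) \<partial>lborel)"
proof -
  have "arc_integral \<rho> \<gamma> c d \<le> (\<integral>\<^sup>+ \<tau> \<in> {\<phi> a..}. \<rho> (\<tau> *\<^sub>R u) \<partial>lborel)"
    if "c \<le> d" "{c..d} \<subseteq> {a..b}" for c d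
  proof -
    have "arc_integral \<rho> \<gamma> c d = (\<integral>\<^sup>+ \<tau> \<in> {\<phi> c..\<phi> d}. \<rho> (\<tau> *\<^sub>R u) \<partial>lborel)"
      using that \<gamma> \<phi> by (intro arc_integral_radial u \<rho>) (auto intro: mono_on_subset continuous_on_subset)
    also have "\<phi> a \<le> \<phi> c"
      using that by (intro mono_onD[OF \<phi>(1)]) auto
    then have "(\<integral>\<^sup>+ \<tau> \<in> {\<phi> c..\<phi> d}. \<rho> (\<tau> *\<^sub>R u) \<partial>lborel) \<le> (\<integral>\<^sup>+ \<tau> \<in> {\<phi> a..}. \<rho> (\<tau> *\<^sub>R u) \<partial>lborel)"
      by (intro nn_integral_mono) (auto simp: indicator_def)
    finally show ?thesis .
  qed
  then show ?thesis
    unfolding line_integral_def by (auto intro!: SUP_least)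
qed

lemma locally_rectifiable_radial:
  assumes \<phi>: "mono_on {a..b} \<phi>" and \<gamma>: "\<And>t. t \<in> {a..b} \<Longrightarrow> \<gamma> t = \<phi> t *\<^sub>R u"
    and u: "norm (u::'a::euclidean_space) = 1"
  shows "locally_rectifiable ({a..b}, \<gamma>)"
  unfolding locally_rectifiable_def
proof (intro allI impI)
  fix c d :: real
  assume "c \<le> d" "{c..d} \<subseteq> fst ({a..b}, \<gamma>)"
  then have "curve_length \<gamma> c d = ennreal (\<phi> d - \<phi> c)"
    using \<gamma> by (intro curve_length_radial[OF _ mono_on_subset[OF \<phi>] _ u]) auto
  then show "curve_length (snd ({a..b}, \<gamma>)) c d < \<infinity>"
    by simp
qed

section \<open>Integration along rays by scaling\<close>

lemma nn_integral_scaleR: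
  fixes F :: "'a::euclidean_space \<Rightarrow> ennreal"
  assumes [measurable]: "F \<in> borel_measurable borel" and "0 < t"
  shows "(\<integral>\<^sup>+ y. F y \<partial>lborel) = ennreal (t ^ DIM('a)) * (\<integral>\<^sup>+ x. F (t *\<^sub>R x) \<partial>lborel)"
proof -
  have "(\<integral>\<^sup>+ y. F y \<partial>lborel) =
      (\<integral>\<^sup>+ y. F y \<partial>density (distr lborel borel (\<lambda>x::'a. 0 + t *\<^sub>R x)) (\<lambda>_. \<bar>t\<bar> ^ DIM('a)))"
    using lborel_affine[of t "0::'a"] \<open>0 < t\<close> by simp
  also have "\<dots> = ennreal (t ^ DIM('a)) * (\<integral>\<^sup>+ x. F (t *\<^sub>R x) \<partial>lborel)"
    using \<open>0 < t\<close> by (simp add: nn_integral_density nn_integral_distr nn_integral_cmult)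
  finally show ?thesis .
qed

text \<open>For positive \<open>r\<close> the value is \<open>ln 2\<close>; width
  \<open>r / 2\<close> times maximal height \<open>2 / r\<close> is precise enough here.\<close>

lemma nn_integral_inverse_dyadic_le:
  assumes "0 \<le> (r::real)"
  shows "(\<integral>\<^sup>+ t. ennreal (1 / t) * indicator {r / 2<..<r} t \<partial>lborel) \<le> 1"
proof -
  have "(\<integral>\<^sup>+ t. ennreal (1 / t) * indicator {r / 2<..<r} t \<partial>lborel)
      \<le> (\<integral>\<^sup>+ t. ennreal (2 / r) * indicator {r / 2<..<r} t \<partial>lborel)"
    using assms by (intro nn_integral_mono) (auto simp: indicator_def field_simps intro!: ennreal_leI)
  also have "\<dots> = ennreal (2 / r) * ennreal (r / 2)"
    using assms by (subst nn_integral_cmult_indicator) auto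
  also have "\<dots> \<le> 1"
    using assms by (simp flip: ennreal_mult)
  finally show ?thesis .
qed

text \<open>A substitute for integration in polar coordinates: each point \<open>y\<close> is \<open>t *\<^sub>R x\<close> with
  \<open>1 < norm x < 2\<close> exactly for \<open>norm y / 2 < t < norm y\<close>.\<close>

lemma nn_integral_radial_average_le:
  fixes G :: "'a::euclidean_space \<Rightarrow> ennreal"
  assumes [measurable]: "G \<in> borel_measurable borel"
  shows "(\<integral>\<^sup>+ x. (\<integral>\<^sup>+ t. G (t *\<^sub>R x) * ennreal (t ^ (DIM('a) - 1)) * indicator {0<..} t \<partial>lborel)
            * indicator (annulus 1 2 0) x \<partial>lborel) \<le> (\<integral>\<^sup>+ y. G y \<partial>lborel)"
proof -
  let ?n = "DIM('a)"
  have ind: "indicator (annulus 1 2 (0::'a)) x = (indicator {1<..<2} (norm x) :: ennreal)" for x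
    by (auto simp: annulus_def indicator_def)
  have "(\<integral>\<^sup>+ x. (\<integral>\<^sup>+ t. G (t *\<^sub>R x) * ennreal (t ^ (?n - 1)) * indicator {0<..} t \<partial>lborel)
            * indicator (annulus 1 2 0) x \<partial>lborel)
      = (\<integral>\<^sup>+ x. (\<integral>\<^sup>+ t. G (t *\<^sub>R x) * ennreal (t ^ (?n - 1)) * indicator {0<..} t
            * indicator {1<..<2} (norm x) \<partial>lborel) \<partial>(lborel :: 'a measure))"
    unfolding ind by (intro nn_integral_cong nn_integral_multc[symmetric]) measurable
  also have "\<dots> = (\<integral>\<^sup>+ t. (\<integral>\<^sup>+ x. G (t *\<^sub>R x) * ennreal (t ^ (?n - 1)) * indicator {0<..} t
            * indicator {1<..<2} (norm x) \<partial>(lborel :: 'a measure)) \<partial>lborel)"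
    by (intro lborel_pair.Fubini') measurable
  \<comment> \<open>For fixed positive \<open>t\<close>, substituting
    \<open>y = t *\<^sub>R x\<close> costs a factor \<open>t ^ ?n\<close>, which reduces the weight
    \<open>t ^ (?n - 1)\<close> to \<open>1 / t\<close>. The condition on \<open>norm x\<close>
    becomes a dyadic interval for \<open>t\<close> determined by \<open>norm y\<close>. For other
    \<open>t\<close> both integrands vanish.\<close>
  also have "\<dots> = (\<integral>\<^sup>+ t. (\<integral>\<^sup>+ y. G y * (ennreal (1 / t) * indicator {norm y / 2<..<norm y} t)
            \<partial>(lborel :: 'a measure)) \<partial>lborel)"
  proof (rule nn_integral_cong)
    fix t :: real
    show "(\<integral>\<^sup>+ x. G (t *\<^sub>R x) * ennreal (t ^ (?n - 1)) * indicator {0<..} t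
            * indicator {1<..<2} (norm x) \<partial>(lborel :: 'a measure))
        = (\<integral>\<^sup>+ y. G y * (ennreal (1 / t) * indicator {norm y / 2<..<norm y} t) \<partial>lborel)"
    proof (cases "0 < t")
      case True
      have "t ^ ?n = t * t ^ (?n - 1)"
        by (simp add: power_eq_if)
      then have pw: "ennreal (t ^ ?n) * ennreal (1 / t) = ennreal (t ^ (?n - 1))"
        using True by (simp flip: ennreal_mult)
      have "(\<integral>\<^sup>+ y. G y * (ennreal (1 / t) * indicator {norm y / 2<..<norm y} t) \<partial>lborel)
          = ennreal (t ^ ?n) * (\<integral>\<^sup>+ x. G (t *\<^sub>R x) * (ennreal (1 / t)
              * indicator {norm (t *\<^sub>R x) / 2<..<norm (t *\<^sub>R x)} t) \<partial>lborel)"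
        by (rule nn_integral_scaleR[OF _ True]) (simp add: indicator_def)
      also have "\<dots> = (\<integral>\<^sup>+ x. ennreal (t ^ ?n) * (G (t *\<^sub>R x) * (ennreal (1 / t)
              * indicator {norm (t *\<^sub>R x) / 2<..<norm (t *\<^sub>R x)} t)) \<partial>lborel)"
        by (rule nn_integral_cmult[symmetric]) (simp add: indicator_def)
      also have "\<dots> = (\<integral>\<^sup>+ x. G (t *\<^sub>R x) * ennreal (t ^ (?n - 1)) * indicator {0<..} t
            * indicator {1<..<2} (norm x) \<partial>(lborel :: 'a measure))"
      proof (intro nn_integral_cong)
        fix x :: 'a
        have "indicator {norm (t *\<^sub>R x) / 2<..<norm (t *\<^sub>R x)} t = (indicator {1<..<2} (norm x) :: ennreal)"
          using True by (auto simp: indicator_def field_simps)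
        moreover have "indicator {0<..} t = (1::ennreal)"
          using True by simp
        ultimately show "ennreal (t ^ ?n) * (G (t *\<^sub>R x) * (ennreal (1 / t)
              * indicator {norm (t *\<^sub>R x) / 2<..<norm (t *\<^sub>R x)} t))
            = G (t *\<^sub>R x) * ennreal (t ^ (?n - 1)) * indicator {0<..} t * indicator {1<..<2} (norm x)"
          by (simp only: pw[symmetric] mult_ac mult_1_right mult_1_left)
      qed
      finally show ?thesis
        by simp
    next
      case False
      then have "indicator {norm y / 2<..<norm y} t = (0::ennreal)" for y :: 'a
        using norm_ge_zero[of y] by (simp add: indicator_def del: norm_ge_zero)
      with False show ?thesis
        by simp
    qed
  qed
  also have "\<dots> = (\<integral>\<^sup>+ y. (\<integral>\<^sup>+ t. G y * (ennreal (1 / t) * indicator {norm y / 2<..<norm y} t)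
            \<partial>lborel) \<partial>(lborel :: 'a measure))"
    by (intro lborel_pair.Fubini') (simp add: indicator_def)
  also have "\<dots> \<le> (\<integral>\<^sup>+ y. G y \<partial>lborel)"
  proof (intro nn_integral_mono)
    fix y :: 'a
    have "(\<integral>\<^sup>+ t. G y * (ennreal (1 / t) * indicator {norm y / 2<..<norm y} t) \<partial>lborel)
        = G y * (\<integral>\<^sup>+ t. ennreal (1 / t) * indicator {norm y / 2<..<norm y} t \<partial>lborel)"
      by (intro nn_integral_cmult) measurable
    also have "\<dots> \<le> G y * 1"
      by (intro mult_left_mono nn_integral_inverse_dyadic_le) auto
    finally show "(\<integral>\<^sup>+ t. G y * (ennreal (1 / t) * indicator {norm y / 2<..<norm y} t) \<partial>lborel) \<le> G y"
      by simp
  qed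
  finally show ?thesis .
qed

section \<open>Energy of a density on a single ray\<close>

lemma ennreal_powr_measurable [measurable (raw)]:
  assumes [measurable]: "f \<in> borel_measurable M"
  shows "(\<lambda>x. ennreal_powr (f x) p) \<in> borel_measurable M"
  unfolding ennreal_powr_def by measurable

text \<open>Either the first summand already dominates, or \<open>r\<close> exceeds \<open>w\<close>
  and may be multiplied by \<open>(r / w) powr (p - 1)\<close>, which is at least \<open>1\<close>
  and produces the second summand.\<close>

lemma ennreal_le_weight_add_powr:
  assumes "0 < w" "1 \<le> p"
  shows "r \<le> ennreal w + ennreal_powr r p * ennreal (w powr (1 - p))"
proof (cases "r = \<infinity>")
  case True
  then show ?thesis
    using assms by (simp add: ennreal_powr_def ennreal_top_mult)
next
  case False
  then obtain x where x: "r = ennreal x" "0 \<le> x"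
    by (cases r) auto
  have "x \<le> w + x powr p * w powr (1 - p)"
  proof (cases "x \<le> w")
    case False
    then have "x = x powr p * x powr (1 - p)"
      using assms by (simp flip: powr_add)
    also have "\<dots> \<le> x powr p * w powr (1 - p)"
      using False assms by (intro mult_left_mono powr_mono2') auto
    finally show ?thesis
      using assms by simp
  qed (use assms in \<open>simp add: add_increasing2\<close>)
  then show ?thesis
    using x assms by (simp add: ennreal_powr_def flip: ennreal_mult ennreal_plus)
qed

lemma nn_integral_powr_atLeast:
  assumes "0 < l" "1 < \<alpha>"
  shows "(\<integral>\<^sup>+ \<tau> \<in> {l..}. ennreal (\<tau> powr - \<alpha>) \<partial>lborel) = ennreal (l powr (1 - \<alpha>) / (\<alpha> - 1))"
proof -
  have "(\<integral>\<^sup>+ \<tau> \<in> {l..}. ennreal (\<tau> powr - \<alpha>) \<partial>lborel) =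
      ennreal (0 - - (l powr (1 - \<alpha>)) / (\<alpha> - 1))"
  proof (rule nn_integral_FTC_atLeast[where F = "\<lambda>\<tau>. - (\<tau> powr (1 - \<alpha>)) / (\<alpha> - 1)"])
    show "((\<lambda>\<tau>. - (\<tau> powr (1 - \<alpha>)) / (\<alpha> - 1)) has_real_derivative x powr - \<alpha>) (at x)" if "l \<le> x" for x
    proof -
      have "((\<lambda>\<tau>. \<tau> powr (1 - \<alpha>)) has_real_derivative (1 - \<alpha>) * x powr (1 - \<alpha> - 1)) (at x)"
        using assms that by (intro has_real_derivative_powr) auto
      from DERIV_cdivide[OF DERIV_minus[OF this], of "\<alpha> - 1"] show ?thesis
        by (rule DERIV_cong) (use assms in \<open>simp add: divide_eq_eq algebra_simps\<close>)
    qed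
    have "((\<lambda>\<tau>. \<tau> powr (1 - \<alpha>)) \<longlongrightarrow> 0) at_top"
      using assms by (intro tendsto_neg_powr filterlim_ident) auto
    from tendsto_divide[OF tendsto_minus[OF this] tendsto_const, of "\<alpha> - 1"]
    show "((\<lambda>\<tau>. - (\<tau> powr (1 - \<alpha>)) / (\<alpha> - 1)) \<longlongrightarrow> 0) at_top"
      using assms by simp
  qed auto
  then show ?thesis
    by simp
qed


text \<open>Hoelder's inequality on the ray, replaced by \<open>\<rho> \<le> w + \<rho>\<^sup>p w\<^bsup>1 - p\<^esup>\<close> for the multiple \<open>w\<close> of
  the extremal weight with integral \<open>1 / 2\<close> over \<open>{l..}\<close>.\<close>

lemma radial_energy_lower_bound:
  fixes \<rho> :: "real \<Rightarrow> ennreal"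
  assumes p: "1 < p" "p < real n" and "0 < l"
    and [measurable]: "\<rho> \<in> borel_measurable borel"
    and one: "1 \<le> (\<integral>\<^sup>+ \<tau> \<in> {l..}. \<rho> \<tau> \<partial>lborel)"
  shows "ennreal (((n - p) / (2 * (p - 1))) powr (p - 1) / 2 * l powr (n - p)) \<le>
    (\<integral>\<^sup>+ \<tau> \<in> {0<..}. ennreal_powr (\<rho> \<tau>) p * ennreal (\<tau> ^ (n - 1)) \<partial>lborel)"
proof -
  \<comment> \<open>Minimizing the energy at fixed integral forces
    \<open>\<rho> powr (p - 1) * \<tau> ^ (n - 1)\<close> to be constant, hence
    \<open>\<rho>\<close> proportional to \<open>\<tau> powr - \<alpha>\<close>. The inequality
    \<open>1 < \<alpha>\<close> is \<open>p < n\<close>. The factor \<open>c\<close> normalizes the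
    integral of \<open>w\<close> to \<open>1 / 2\<close>; any value below \<open>1\<close> would
    serve with another constant.\<close>
  define \<alpha> where "\<alpha> = (real n - 1) / (p - 1)"
  define c where "c = (\<alpha> - 1) / 2"
  have \<alpha>: "1 < \<alpha>" "\<alpha> * (p - 1) = real n - 1"
    using p by (simp_all add: \<alpha>_def field_simps)
  have c: "0 < c" "c = (n - p) / (2 * (p - 1))"
    using \<alpha>(1) p by (simp_all add: c_def \<alpha>_def field_simps)
  define w where "w \<tau> = c * l powr (\<alpha> - 1) * \<tau> powr - \<alpha>" for \<tau> :: real
  define J where "J = (\<integral>\<^sup>+ \<tau> \<in> {0<..}. ennreal_powr (\<rho> \<tau>) p * ennreal (\<tau> ^ (n - 1)) \<partial>lborel)"
  define k where "k = c powr (1 - p) * l powr (p - n)"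
  have k: "0 < k"
    using c(1) \<open>0 < l\<close> unfolding k_def by simp
  \<comment> \<open>For this \<open>\<alpha>\<close> the factor \<open>w \<tau> powr (1 - p)\<close>
    is the weight of the energy up to the constant \<open>k\<close>. Integrating the pointwise
    inequality therefore gives \<open>1 \<le> 1 / 2 + k * J\<close>, and the remaining half bounds
    \<open>J\<close> from below.\<close>
  have w_pow: "w \<tau> powr (1 - p) = k * \<tau> ^ (n - 1)" if "0 < \<tau>" for \<tau>
  proof -
    have "(\<alpha> - 1) * (1 - p) = p - n"
      using \<alpha>(2) by (simp add: algebra_simps)
    moreover have "- \<alpha> * (1 - p) = real (n - 1)"
      using \<alpha>(2) p by (simp add: of_nat_diff algebra_simps)
    ultimately show ?thesis
      using c(1) \<open>0 < l\<close> that
      by (simp add: w_def k_def powr_mult powr_powr powr_realpow del: minus_mult_minus)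
  qed
  have half: "(\<integral>\<^sup>+ \<tau> \<in> {l..}. ennreal (w \<tau>) \<partial>lborel) = ennreal (1 / 2)"
  proof -
    have "(\<integral>\<^sup>+ \<tau> \<in> {l..}. ennreal (w \<tau>) \<partial>lborel)
        = (\<integral>\<^sup>+ \<tau>. ennreal (c * l powr (\<alpha> - 1)) * (ennreal (\<tau> powr - \<alpha>) * indicator {l..} \<tau>) \<partial>lborel)"
      using c(1) by (intro nn_integral_cong) (simp add: w_def ennreal_mult mult_ac)
    also have "\<dots> = ennreal (c * l powr (\<alpha> - 1)) * ennreal (l powr (1 - \<alpha>) / (\<alpha> - 1))"
      using \<open>0 < l\<close> \<alpha>(1) by (simp add: nn_integral_cmult nn_integral_powr_atLeast)
    also have "\<dots> = ennreal (c * (l powr (\<alpha> - 1) * l powr (1 - \<alpha>)) / (\<alpha> - 1))"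
      using c(1) \<alpha>(1) by (simp flip: ennreal_mult)
    also have "l powr (\<alpha> - 1) * l powr (1 - \<alpha>) = 1"
      using \<open>0 < l\<close> by (simp flip: powr_add)
    also have "c * 1 / (\<alpha> - 1) = 1 / 2"
      using \<alpha>(1) by (simp add: c_def)
    finally show ?thesis .
  qed
  have [measurable]: "w \<in> borel_measurable borel"
    unfolding w_def by measurable
  have "1 \<le> (\<integral>\<^sup>+ \<tau> \<in> {l..}. \<rho> \<tau> \<partial>lborel)"
    by (rule one)
  also have "\<dots> \<le> (\<integral>\<^sup>+ \<tau>. ennreal (w \<tau>) * indicator {l..} \<tau> +
      ennreal k * (ennreal_powr (\<rho> \<tau>) p * ennreal (\<tau> ^ (n - 1)) * indicator {0<..} \<tau>) \<partial>lborel)"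
  proof (intro nn_integral_mono)
    fix \<tau> :: real
    show "\<rho> \<tau> * indicator {l..} \<tau> \<le> ennreal (w \<tau>) * indicator {l..} \<tau> +
        ennreal k * (ennreal_powr (\<rho> \<tau>) p * ennreal (\<tau> ^ (n - 1)) * indicator {0<..} \<tau>)"
    proof (cases "l \<le> \<tau>")
      case True
      then have "0 < \<tau>" "0 < w \<tau>"
        using \<open>0 < l\<close> c(1) by (auto simp: w_def)
      then show ?thesis
        using True ennreal_le_weight_add_powr[of "w \<tau>" p "\<rho> \<tau>"] p(1) k
        by (simp add: w_pow ennreal_mult mult_ac)
    qed simp
  qed
  also have "\<dots> = ennreal (1 / 2) + ennreal k * J"
    by (simp add: nn_integral_add half nn_integral_cmult J_def)
  finally have ge: "1 \<le> ennreal (1 / 2) + ennreal k * J" .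
  show ?thesis
  proof (cases "J = \<infinity>")
    case False
    then obtain j where j: "J = ennreal j" "0 \<le> j"
      by (cases J) auto
    have "ennreal 1 \<le> ennreal (1 / 2 + k * j)"
      using ge j(2) k unfolding j(1) by (subst ennreal_plus) (auto simp: ennreal_mult)
    then have "1 \<le> 1 / 2 + k * j"
      using j(2) k by (subst (asm) ennreal_le_iff) auto
    then have "1 / (2 * k) \<le> j"
      using k by (simp add: field_simps)
    moreover have "c powr (p - 1) / 2 * l powr (n - p) = 1 / (2 * k)"
    proof -
      have "c powr (p - 1) * c powr (1 - p) = 1" "l powr (n - p) * l powr (p - n) = 1"
        using c(1) \<open>0 < l\<close> by (simp_all flip: powr_add)
      moreover have "c powr (p - 1) * l powr (n - p) * k =
          (c powr (p - 1) * c powr (1 - p)) * (l powr (n - p) * l powr (p - n))"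
        by (simp add: k_def mult_ac)
      ultimately have "c powr (p - 1) * l powr (n - p) * k = 1"
        by simp
      then show ?thesis
        using k by (simp add: field_simps)
    qed
    ultimately show ?thesis
      using j unfolding J_def[symmetric] c(2)[symmetric] by (simp add: ennreal_leI)
  qed (simp add: J_def)
qed

text \<open>The energy bound holds on every ray with the same constant, so it can be averaged over
  directions. Base points in a ring of positive measure take the role of the unit sphere; the price
  is the factor \<open>2 ^ DIM('a)\<close> in \<kappa>.\<close>

lemma modulus_radial_lower_bound:
  fixes p :: real
  assumes p: "1 < p" "p < real DIM('a::euclidean_space)"
  obtains \<kappa> where "0 < \<kappa>" "\<And>l \<Gamma>. \<lbrakk>0 < l; \<And>u::'a. norm u = 1 \<Longrightarrow>
      \<exists>a b \<gamma> \<phi>. ({a..b}, \<gamma>) \<in> \<Gamma> \<and> mono_on {a..b} \<phi> \<and> continuous_on {a..b} \<phi> \<and> l \<le> \<phi> a \<and>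
        (\<forall>t\<in>{a..b}. \<gamma> t = \<phi> t *\<^sub>R u)\<rbrakk>
    \<Longrightarrow> ennreal (\<kappa> * l powr (DIM('a) - p)) \<le> modulus p \<Gamma>"
proof -
  let ?n = "DIM('a)" and ?A = "annulus 1 2 (0::'a)"
  define k where "k = ((real ?n - p) / (2 * (p - 1))) powr (p - 1) / 2"
  have k: "0 < k"
    using p by (simp add: k_def)
  have A: "?A = ball 0 2 - cball 0 1"
    by (auto simp: annulus_def)
  then have fin: "?A \<in> fmeasurable lborel"
    by (intro fmeasurableI2[OF fmeasurableI[of "ball 0 2"]]) (auto simp: emeasure_lborel_ball_finite[unfolded infinity_ennreal_def])
  have "open ?A"
    unfolding A by (intro open_Diff) auto
  obtain e :: 'a where "norm e = 3 / 2"
    using vector_choose_size[of "3 / 2"] by auto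
  then have "?A \<noteq> {}"
    by (auto simp: annulus_def intro!: exI[of _ e])
  then have "emeasure lborel ?A \<noteq> 0"
    using \<open>open ?A\<close> open_not_negligible[of ?A]
    by (auto simp: negligible_iff_null_sets null_sets_def intro!: null_sets_completionI)
  then have A0: "0 < measure lborel ?A"
    using fin by (simp add: measure_def enn2real_positive_iff fmeasurable_def zero_less_iff_neq_zero less_top)
  show thesis
  proof
    show "0 < measure lborel ?A * k / 2 ^ ?n"
      using A0 k by simp
    fix l :: real and \<Gamma> :: "'a curve set"
    assume "0 < l" and \<Gamma>: "\<And>u::'a. norm u = 1 \<Longrightarrow>
      \<exists>a b \<gamma> \<phi>. ({a..b}, \<gamma>) \<in> \<Gamma> \<and> mono_on {a..b} \<phi> \<and> continuous_on {a..b} \<phi> \<and> l \<le> \<phi> a \<and>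
        (\<forall>t\<in>{a..b}. \<gamma> t = \<phi> t *\<^sub>R u)"
    show "ennreal (measure lborel ?A * k / 2 ^ ?n * l powr (real ?n - p)) \<le> modulus p \<Gamma>"
      unfolding modulus_def
    proof (rule INF_greatest)
      fix \<rho>
      assume "\<rho> \<in> {\<rho>. admissible \<rho> \<Gamma>}"
      then have \<rho>[measurable]: "\<rho> \<in> borel_measurable borel"
        and adm: "\<And>c. c \<in> \<Gamma> \<Longrightarrow> locally_rectifiable c \<Longrightarrow> 1 \<le> line_integral \<rho> c"
        by (auto simp: admissible_def)
      define G where "G x = ennreal_powr (\<rho> x) p" for x
      have [measurable]: "G \<in> borel_measurable borel"
        unfolding G_def by measurable
      define H where "H x = (\<integral>\<^sup>+ t. G (t *\<^sub>R x) * ennreal (t ^ (?n - 1)) * indicator {0<..} t \<partial>lborel)" for x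
      have ray: "ennreal (k * l powr (real ?n - p)) \<le> H u" if u: "norm u = 1" for u
      proof -
        obtain a b \<gamma> \<phi> where \<gamma>: "({a..b}, \<gamma>) \<in> \<Gamma>" "mono_on {a..b} \<phi>" "continuous_on {a..b} \<phi>"
            "l \<le> \<phi> a" "\<And>t. t \<in> {a..b} \<Longrightarrow> \<gamma> t = \<phi> t *\<^sub>R u"
          using \<Gamma>[OF u] by blast
        have "1 \<le> line_integral \<rho> ({a..b}, \<gamma>)"
          by (intro adm \<gamma> locally_rectifiable_radial[OF \<gamma>(2,5) u])
        also have "\<dots> \<le> (\<integral>\<^sup>+ \<tau> \<in> {\<phi> a..}. \<rho> (\<tau> *\<^sub>R u) \<partial>lborel)"
          by (rule line_integral_radial_le[OF \<gamma>(2,3,5) u \<rho>])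
        also have "\<dots> \<le> (\<integral>\<^sup>+ \<tau> \<in> {l..}. \<rho> (\<tau> *\<^sub>R u) \<partial>lborel)"
          using \<gamma>(4) by (intro nn_integral_mono) (auto simp: indicator_def)
        finally show ?thesis
          using radial_energy_lower_bound[OF p \<open>0 < l\<close>, of "\<lambda>\<tau>. \<rho> (\<tau> *\<^sub>R u)"]
          by (simp add: H_def G_def k_def)
      qed
      \<comment> \<open>\<open>H\<close> is homogeneous of degree \<open>- ?n\<close>: the
        substitution \<open>t = norm x * s\<close> gives \<open>H u = norm x ^ ?n * H x\<close>, and
        \<open>norm x < 2\<close>. This carries the bound from unit vectors to the ring.\<close>
      have scaled: "ennreal (k * l powr (real ?n - p)) \<le> ennreal (2 ^ ?n) * H x" if x: "x \<in> ?A" for x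
      proof -
        let ?r = "norm x"
        have r: "1 < ?r" "?r < 2"
          using x by (auto simp: annulus_def)
        define u where "u = x /\<^sub>R ?r"
        have "x \<noteq> 0"
          using r by auto
        then have u: "norm u = 1" "\<And>s. (?r * s) *\<^sub>R u = s *\<^sub>R x"
          by (auto simp: u_def)
        have "H u = ennreal ?r * (\<integral>\<^sup>+ s. G ((0 + ?r * s) *\<^sub>R u) * ennreal ((0 + ?r * s) ^ (?n - 1))
            * indicator {0<..} (0 + ?r * s) \<partial>lborel)"
          unfolding H_def using r by (subst nn_integral_real_affine[where c = ?r and t = 0]) auto
        also have "\<dots> = ennreal ?r * (\<integral>\<^sup>+ s. ennreal (?r ^ (?n - 1)) * (G (s *\<^sub>R x) * ennreal (s ^ (?n - 1))
            * indicator {0<..} s) \<partial>lborel)"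
        proof (rule arg_cong[where f = "(*) (ennreal ?r)"], rule nn_integral_cong)
          fix s :: real
          show "G ((0 + ?r * s) *\<^sub>R u) * ennreal ((0 + ?r * s) ^ (?n - 1)) * indicator {0<..} (0 + ?r * s)
              = ennreal (?r ^ (?n - 1)) * (G (s *\<^sub>R x) * ennreal (s ^ (?n - 1)) * indicator {0<..} s)"
          proof (cases "0 < s")
            case True
            have "0 < ?r * s"
              using True r by (intro mult_pos_pos) auto
            with True show ?thesis
              using r by (simp add: u power_mult_distrib ennreal_mult mult.assoc mult.left_commute)
          next
            case False
            then have "\<not> 0 < ?r * s"
              using r by (simp add: mult_le_0_iff not_less)
            with False show ?thesis
              by simp
          qed
        qed
        also have "\<dots> = ennreal ?r * (ennreal (?r ^ (?n - 1)) * H x)"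
          by (simp add: nn_integral_cmult H_def)
        also have "\<dots> = ennreal (?r ^ ?n) * H x"
          by (simp add: power_eq_if[of ?r ?n] ennreal_mult mult_ac)
        also have "\<dots> \<le> ennreal (2 ^ ?n) * H x"
          using r by (intro mult_right_mono ennreal_leI power_mono) auto
        finally show ?thesis
          using ray[OF u(1)] by (rule order_trans[rotated])
      qed
      have [measurable]: "?A \<in> sets borel"
        using \<open>open ?A\<close> by simp
      have [measurable]: "H \<in> borel_measurable borel"
        unfolding H_def by measurable
      have "ennreal (measure lborel ?A * k * l powr (real ?n - p))
          = ennreal (k * l powr (real ?n - p)) * emeasure lborel ?A"
        using fin k by (simp add: emeasure_eq_measure2 ennreal_mult mult_ac)
      also have "\<dots> = (\<integral>\<^sup>+ x \<in> ?A. ennreal (k * l powr (real ?n - p)) \<partial>lborel)"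
        by (simp add: nn_integral_cmult_indicator)
      also have "\<dots> \<le> (\<integral>\<^sup>+ x. ennreal (2 ^ ?n) * (H x * indicator ?A x) \<partial>lborel)"
        using scaled by (intro nn_integral_mono) (auto simp: indicator_def)
      also have "\<dots> = ennreal (2 ^ ?n) * (\<integral>\<^sup>+ x \<in> ?A. H x \<partial>lborel)"
        by (intro nn_integral_cmult) measurable
      also have "\<dots> \<le> ennreal (2 ^ ?n) * (\<integral>\<^sup>+ x. G x \<partial>lborel)"
        unfolding H_def by (intro mult_left_mono nn_integral_radial_average_le) auto
      finally have le: "ennreal (measure lborel ?A * k * l powr (real ?n - p)) \<le> ennreal (2 ^ ?n) * (\<integral>\<^sup>+ x. G x \<partial>lborel)" .
      have "ennreal (measure lborel ?A * k / 2 ^ ?n * l powr (real ?n - p))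
          = ennreal (1 / 2 ^ ?n) * ennreal (measure lborel ?A * k * l powr (real ?n - p))"
        using k by (simp flip: ennreal_mult)
      also have "\<dots> \<le> ennreal (1 / 2 ^ ?n) * (ennreal (2 ^ ?n) * (\<integral>\<^sup>+ x. G x \<partial>lborel))"
        using le by (intro mult_left_mono) auto
      also have "\<dots> = (\<integral>\<^sup>+ x. G x \<partial>lborel)"
        by (simp add: mult.assoc[symmetric] flip: ennreal_mult)
      finally show "ennreal (measure lborel ?A * k / 2 ^ ?n * l powr (real ?n - p))
          \<le> (\<integral>\<^sup>+ x. ennreal_powr (\<rho> x) p \<partial>lebesgue)"
        by (simp add: nn_integral_completion G_def)
    qed
  qed
qed

section \<open>Growth at the origin\<close>

text \<open>The order of the choices matters: \<open>b\<close> is the first time at level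
  \<open>r2\<close>, and \<open>a\<close> the last time at level \<open>r1\<close> before
  \<open>b\<close>. Any further excursion beyond either level between them would, by the
  intermediate value theorem, contradict one of the two choices.\<close>

lemma real_crossing_interval:
  fixes g :: "real \<Rightarrow> real"
  assumes g: "continuous_on {c..d} g" and "c \<le> d" "g c \<le> r1" "r1 < r2" "r2 \<le> g d"
  obtains a b where "c \<le> a" "a < b" "b \<le> d" "g a = r1" "g b = r2"
    "\<And>t. a < t \<Longrightarrow> t < b \<Longrightarrow> r1 < g t \<and> g t < r2"
proof -
  have level: "compact {t\<in>{x..y}. g t = r}" if "c \<le> x" "y \<le> d" for x y r
  proof -
    have "closed ({x..y} \<inter> g -` {r})"
      by (rule continuous_closed_preimage[OF continuous_on_subset[OF g]]) (use that in auto)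
    then have "compact ({x..y} \<inter> ({x..y} \<inter> g -` {r}))"
      by (intro compact_Int_closed) auto
    moreover have "{x..y} \<inter> ({x..y} \<inter> g -` {r}) = {t\<in>{x..y}. g t = r}"
      by auto
    ultimately show ?thesis
      by simp
  qed
  have ivt: "\<exists>t. x \<le> t \<and> t \<le> y \<and> g t = r" if "c \<le> x" "x \<le> y" "y \<le> d" "g x \<le> r" "r \<le> g y" for x y r
    using that by (intro IVT' continuous_on_subset[OF g]) auto
  have "{t\<in>{c..d}. g t = r2} \<noteq> {}"
    using ivt[of c d r2] assms by auto
  from compact_attains_inf[OF level this] obtain b where b: "c \<le> b" "b \<le> d" "g b = r2"
      and bmin: "\<And>t. \<lbrakk>c \<le> t; t \<le> d; g t = r2\<rbrakk> \<Longrightarrow> b \<le> t"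
    by auto
  have "{t\<in>{c..b}. g t = r1} \<noteq> {}"
    using ivt[of c b r1] assms b by auto
  from compact_attains_sup[OF level this] b obtain a where a: "c \<le> a" "a \<le> b" "g a = r1"
      and amax: "\<And>t. \<lbrakk>c \<le> t; t \<le> b; g t = r1\<rbrakk> \<Longrightarrow> t \<le> a"
    by auto
  have "a \<noteq> b"
    using a b assms by auto
  show thesis
  proof (rule that[of a b])
    fix t
    assume t: "a < t" "t < b"
    have "r1 < g t"
    proof (rule ccontr)
      assume "\<not> r1 < g t"
      then obtain t' where "t \<le> t'" "t' \<le> b" "g t' = r1"
        using ivt[of t b r1] a b t assms by auto
      with amax[of t'] t a show False
        by auto
    qed
    moreover have "g t < r2"
    proof (rule ccontr)
      assume "\<not> g t < r2"
      then obtain t' where "c \<le> t'" "t' \<le> t" "g t' = r2"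
        using ivt[of c t r2] a b t assms by auto
      with bmin[of t'] t b show False
        by auto
    qed
    ultimately show "r1 < g t \<and> g t < r2" ..
  qed (use a b \<open>a \<noteq> b\<close> in auto)
qed

text \<open>The lift over the closed ball of radius \<open>r2\<close> may wander back and forth
  across the ring, so it is cut down to one crossing. The crossing starts on the inner sphere, where
  \<open>norm \<circ> f\<close> is at least \<open>l\<close>, and inherits monotonicity of this norm
  from the lift.\<close>

lemma image_connecting_curves_radial:
  fixes f :: "'a::euclidean_space \<Rightarrow> 'a"
  assumes f: "continuous_on (ball 0 1) f" and into: "f ` ball 0 1 \<subseteq> ball 0 1"
    and op: "open_map (top_of_set (ball 0 1)) euclidean f"
    and disc: "discrete_map_on (ball 0 1) f" and f0: "f 0 = 0"
    and r: "0 < r1" "r1 < r2" "r2 < 1" and l: "\<And>x. norm x = r1 \<Longrightarrow> l \<le> norm (f x)"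
    and u: "norm u = 1"
  shows "\<exists>a b \<gamma> \<phi>.
    ({a..b}, \<gamma>) \<in> image_curves f (connecting_curves (sphere 0 r1) (sphere 0 r2) (annulus r1 r2 0)) \<and>
    mono_on {a..b} \<phi> \<and> continuous_on {a..b} \<phi> \<and> l \<le> \<phi> a \<and> (\<forall>t\<in>{a..b}. \<gamma> t = \<phi> t *\<^sub>R u)"
proof -
  let ?K = "cball (0::'a) r2"
  have sub: "?K \<subseteq> ball 0 1"
    using r by auto
  have fK: "continuous_on ?K f"
    using continuous_on_subset[OF f sub] .
  have discK: "discrete {x\<in>?K. f x = y}" for y
  proof -
    have "discrete {x\<in>ball 0 1. f x = y}"
      using disc by (simp add: discrete_map_on_def)
    then show ?thesis
      using sub unfolding discrete_altdef by (fastforce elim: eventually_mono)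
  qed
  have opK: "open (f ` U)" if "open U" "U \<subseteq> ?K" for U
    using op that sub unfolding open_map_def by (simp add: openin_open_eq subset_trans)
  have bd: "norm (f x) < 1" if "x \<in> ?K" for x
    using into sub that by force
  obtain s where s: "continuous_on {0..1::real} s" "s \<in> {0..1} \<rightarrow> ?K" "s 0 = 0" "s 1 \<notin> interior ?K"
      "mono_on {0..1} (\<lambda>t. norm (f (s t)))" "\<And>t. t \<in> {0..1} \<Longrightarrow> f (s t) = norm (f (s t)) *\<^sub>R u"
    by (rule ray_lift[OF _ fK discK opK bd u, of 0]) (use r f0 in auto)
  have "continuous_on {0..1} (\<lambda>t. norm (s t))"
    using s(1) by (intro continuous_intros)
  then obtain a b where ab: "0 \<le> a" "a < b" "b \<le> 1" "norm (s a) = r1" "norm (s b) = r2"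
      "\<And>t. a < t \<Longrightarrow> t < b \<Longrightarrow> r1 < norm (s t) \<and> norm (s t) < r2"
    by (rule real_crossing_interval[of 0 1 _ r1 r2]) (use s(3,4) r in auto)
  have I: "{a..b} \<subseteq> {0..1}"
    using ab by auto
  have "({a..b}, s) \<in> connecting_curves (sphere 0 r1) (sphere 0 r2) (annulus r1 r2 0)"
    using ab continuous_on_subset[OF s(1) I] by (auto simp: connecting_curves_def annulus_def)
  then have "({a..b}, f \<circ> s) \<in> image_curves f (connecting_curves (sphere 0 r1) (sphere 0 r2) (annulus r1 r2 0))"
    by (force simp: image_curves_def)
  moreover have "continuous_on {a..b} (\<lambda>t. norm (f (s t)))"
    using s(2) I
    by (intro continuous_on_norm continuous_on_compose2[OF fK] continuous_on_subset[OF s(1) I]) auto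
  moreover have "(f \<circ> s) t = norm (f (s t)) *\<^sub>R u" if "t \<in> {a..b}" for t
    using s(6) I that by auto
  ultimately show ?thesis
    using l[OF ab(4)] mono_on_subset[OF s(5) I]
    by (intro exI[of _ a] exI[of _ b] exI[of _ "f \<circ> s"] exI[of _ "\<lambda>t. norm (f (s t))"]) auto
qed

lemma ring_mapping_modulus_le:
  fixes f :: "'a::euclidean_space \<Rightarrow> 'a"
  assumes ring: "ring_mapping p Q (ball 0 1) f" and R: "0 < R" "R < 1"
  shows "modulus p (image_curves f (connecting_curves (sphere 0 (R / 2)) (sphere 0 R) (annulus (R / 2) R 0)))
    \<le> ennreal ((2 / R) powr p) * (\<integral>\<^sup>+ x \<in> ball 0 R. Q x \<partial>lebesgue)"
proof -
  let ?\<eta> = "\<lambda>_::real. ennreal (2 / R)"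
  have "ereal R < ereal 1"
    using R by simp
  also have "ereal 1 \<le> (INF y\<in>frontier (ball (0::'a) 1). ereal (dist 0 y))"
    by (rule INF_greatest) simp
  finally have dist: "ereal R < (INF y\<in>frontier (ball (0::'a) 1). ereal (dist 0 y))" .
  have "(\<integral>\<^sup>+ r \<in> {R / 2<..<R}. ?\<eta> r \<partial>lebesgue) = ennreal (2 / R) * ennreal (R / 2)"
    using R by (subst nn_integral_cmult_indicator) auto
  then have one: "1 \<le> (\<integral>\<^sup>+ r \<in> {R / 2<..<R}. ?\<eta> r \<partial>lebesgue)"
    using R by (simp flip: ennreal_mult)
  have Q: "Q \<in> borel_measurable (lebesgue_on (ball 0 1))"
    and at0: "ring_mapping_at p Q (ball 0 1) f 0"
    using ring by (auto simp: ring_mapping_def)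
  \<comment> \<open>Outside the unit ball \<open>Q\<close> is arbitrary, so measurability on the
    whole space is available only after cutting it off; the smaller ball of radius \<open>R\<close>
    absorbs the first cut-off.\<close>
  have "(\<lambda>x. Q x * indicator (ball 0 1) x) \<in> borel_measurable lebesgue"
    using Q by (subst (asm) borel_measurable_restrict_space_iff_ennreal) auto
  then have "(\<lambda>x. Q x * indicator (ball 0 1) x * indicator (ball 0 R) x) \<in> borel_measurable lebesgue"
    by (rule borel_measurable_times_ennreal) (rule borel_measurable_indicator, simp)
  moreover have "(\<lambda>x. Q x * indicator (ball 0 1) x * indicator (ball 0 R) x) = (\<lambda>x. Q x * indicator (ball 0 R) x)"
    using R by (auto simp: indicator_def)
  ultimately have meas: "(\<lambda>x. Q x * indicator (ball 0 R) x) \<in> borel_measurable lebesgue"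
    by simp
  have "modulus p (image_curves f (connecting_curves (sphere 0 (R / 2)) (sphere 0 R) (annulus (R / 2) R 0)))
      \<le> (\<integral>\<^sup>+ x \<in> annulus (R / 2) R 0. Q x * ennreal_powr (?\<eta> (dist x 0)) p \<partial>lebesgue)"
    by (rule at0[unfolded ring_mapping_at_def, rule_format, OF _ _ dist _ one]) (use R in simp_all)
  also have "\<dots> \<le> (\<integral>\<^sup>+ x. ennreal ((2 / R) powr p) * (Q x * indicator (ball 0 R) x) \<partial>lebesgue)"
    using R by (intro nn_integral_mono) (auto simp: indicator_def annulus_def ennreal_powr_def mult_ac)
  also have "\<dots> = ennreal ((2 / R) powr p) * (\<integral>\<^sup>+ x \<in> ball 0 R. Q x \<partial>lebesgue)"
    by (rule nn_integral_cmult[OF meas])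
  finally show ?thesis .
qed

section \<open>Comparison of the two modulus bounds\<close>

lemma lower_mean_at_0_less_imp:
  fixes Q :: "'a::euclidean_space \<Rightarrow> ennreal"
  assumes "lower_mean_at_0 Q < ennreal q" "0 < d"
  obtains R where "0 < R" "R < d"
    "(\<integral>\<^sup>+ x \<in> ball 0 R. Q x \<partial>lebesgue) \<le> ennreal (q * (measure lebesgue (ball (0::'a) 1) * R ^ DIM('a)))"
proof -
  let ?c = "\<lambda>R. measure lebesgue (ball (0::'a) 1) * R ^ DIM('a)"
  have "\<exists>R>0. R < d \<and> (\<integral>\<^sup>+ x \<in> ball 0 R. Q x \<partial>lebesgue) / ennreal (?c R) < ennreal q"
  proof (rule ccontr)
    assume "\<not> ?thesis"
    then have "\<forall>\<^sub>F R in at_right 0. ennreal q \<le> (\<integral>\<^sup>+ x \<in> ball 0 R. Q x \<partial>lebesgue) / ennreal (?c R)"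
      unfolding eventually_at_right_field using \<open>0 < d\<close> by (intro exI[of _ d]) (meson not_less)
    then have "ennreal q \<le> lower_mean_at_0 Q"
      unfolding lower_mean_at_0_def by (rule Liminf_bounded)
    with assms(1) show False
      by simp
  qed
  then obtain R where R: "0 < R" "R < d" "(\<integral>\<^sup>+ x \<in> ball 0 R. Q x \<partial>lebesgue) / ennreal (?c R) < ennreal q"
    by blast
  have c: "0 < ?c R"
    using R(1) content_ball_pos[of 1 "0::'a"] by simp
  have "0 < q"
    using assms(1) by (metis ennreal_neg not_less not_less_zero)
  have "(\<integral>\<^sup>+ x \<in> ball 0 R. Q x \<partial>lebesgue) < ennreal q * ennreal (?c R)"
    using R(3) divide_less_ennreal[of "ennreal (?c R)"] c by (metis ennreal_eq_0_iff ennreal_less_top not_le)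
  also have "\<dots> = ennreal (q * ?c R)"
    using \<open>0 < q\<close> c by (simp add: ennreal_mult)
  finally show thesis
    using R by (intro that[of R]) auto
qed

text \<open>The comparison is run for positive \<open>q\<close> strictly above the lower mean:
  strictness provides a radius whose mean is at most \<open>q\<close>, and positivity keeps the
  level \<open>l\<close> positive even if the lower mean is zero.\<close>

lemma ring_mapping_liminf_le:
  fixes p :: real
  assumes p: "1 < p" "p < real DIM('a::euclidean_space)"
  obtains c0 where "0 < c0" "\<And>(Q :: 'a \<Rightarrow> ennreal) f.
    \<lbrakk>lower_mean_at_0 Q < \<infinity>; f ` ball 0 1 \<subseteq> ball 0 1;
     open_map (top_of_set (ball 0 1)) euclidean f; discrete_map_on (ball 0 1) f;
     ring_mapping p Q (ball 0 1) f; f 0 = 0\<rbrakk>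
    \<Longrightarrow> Liminf (at 0) (\<lambda>x. ennreal (norm (f x) / norm x))
      \<le> ennreal c0 * ennreal_powr (lower_mean_at_0 Q) (1 / (real DIM('a) - p))"
proof -
  let ?n = "DIM('a)" and ?\<beta> = "1 / (real DIM('a) - p)"
  obtain \<kappa> where \<kappa>: "0 < \<kappa>" "\<And>l \<Gamma>. \<lbrakk>0 < l; \<And>u::'a. norm u = 1 \<Longrightarrow>
      \<exists>a b \<gamma> \<phi>. ({a..b}, \<gamma>) \<in> \<Gamma> \<and> mono_on {a..b} \<phi> \<and> continuous_on {a..b} \<phi> \<and> l \<le> \<phi> a \<and>
        (\<forall>t\<in>{a..b}. \<gamma> t = \<phi> t *\<^sub>R u)\<rbrakk>
    \<Longrightarrow> ennreal (\<kappa> * l powr (real ?n - p)) \<le> modulus p \<Gamma>"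
    using modulus_radial_lower_bound[OF p] by blast
  define \<Omega> where "\<Omega> = measure lebesgue (ball (0::'a) 1)"
  have \<Omega>: "0 < \<Omega>"
    unfolding \<Omega>_def by (simp add: content_ball_pos)
  \<comment> \<open>The factor \<open>2 ^ ?n\<close> comes from measuring \<open>f\<close> on the
    sphere of radius \<open>R / 2\<close>, \<open>\<Omega>\<close> from the normalization of the
    mean, and \<open>\<kappa>\<close> from the modulus bound. One more factor \<open>2\<close> makes
    the lower bound twice the upper one, which is the contradiction.\<close>
  define C where "C = 2 ^ (?n + 1) * \<Omega> / \<kappa>"
  have C: "0 < C"
    using \<Omega> \<kappa>(1) by (simp add: C_def)
  show thesis
  proof
    show "0 < C powr ?\<beta>"
      using C by simp
    fix Q :: "'a \<Rightarrow> ennreal" and f :: "'a \<Rightarrow> 'a"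
    assume fin: "lower_mean_at_0 Q < \<infinity>" and into: "f ` ball 0 1 \<subseteq> ball 0 1"
      and op: "open_map (top_of_set (ball 0 1)) euclidean f" and disc: "discrete_map_on (ball 0 1) f"
      and ring: "ring_mapping p Q (ball 0 1) f" and f0: "f 0 = 0"
    have cont: "continuous_on (ball 0 1) f"
      using ring by (simp add: ring_mapping_def)
    have small: "\<exists>x. x \<noteq> 0 \<and> norm x < d \<and> norm (f x) / norm x \<le> (C * q) powr ?\<beta>"
      if q: "lower_mean_at_0 Q < ennreal q" "0 < q" and "0 < d" for q d
    proof (rule ccontr)
      assume none: "\<not> ?thesis"
      obtain R where R: "0 < R" "R < min d 1"
          and int: "(\<integral>\<^sup>+ x \<in> ball 0 R. Q x \<partial>lebesgue) \<le> ennreal (q * (\<Omega> * R ^ ?n))"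
        using lower_mean_at_0_less_imp[OF q(1), of "min d 1"] \<open>0 < d\<close> unfolding \<Omega>_def by auto
      \<comment> \<open>The negated claim makes this a lower bound for \<open>norm (f x)\<close> on
        the whole inner sphere. The exponent \<open>?\<beta>\<close> is chosen so that
        \<open>l powr (n - p)\<close> is linear in \<open>q\<close>, as is the upper bound.\<close>
      define l where "l = (C * q) powr ?\<beta> * (R / 2)"
      have "0 < l"
        using C q R by (simp add: l_def)
      have l: "l \<le> norm (f x)" if "norm x = R / 2" for x
      proof -
        have "x \<noteq> 0" "norm x < d"
          using that R by auto
        then have "(C * q) powr ?\<beta> < norm (f x) / norm x"
          using none by (meson not_le)
        then show ?thesis
          using that R by (simp add: l_def field_simps)
      qed
      have "ennreal (\<kappa> * l powr (real ?n - p))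
          \<le> modulus p (image_curves f (connecting_curves (sphere 0 (R / 2)) (sphere 0 R) (annulus (R / 2) R 0)))"
        by (intro \<kappa>(2) \<open>0 < l\<close> image_connecting_curves_radial[OF cont into op disc f0 _ _ _ l]) (use R in auto)
      also have "\<dots> \<le> ennreal ((2 / R) powr p) * (\<integral>\<^sup>+ x \<in> ball 0 R. Q x \<partial>lebesgue)"
        using R by (intro ring_mapping_modulus_le[OF ring]) auto
      also have "\<dots> \<le> ennreal ((2 / R) powr p) * ennreal (q * (\<Omega> * R ^ ?n))"
        by (intro mult_left_mono int) simp
      also have "\<dots> = ennreal ((2 / R) powr p * (q * (\<Omega> * R ^ ?n)))"
        using q(2) \<Omega> R by (simp add: ennreal_mult)
      finally have "\<kappa> * l powr (real ?n - p) \<le> (2 / R) powr p * (q * (\<Omega> * R ^ ?n))"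
        using q(2) \<Omega> R by (simp add: ennreal_le_iff)
      moreover have "l powr (real ?n - p) = C * q * ((R / 2) powr (real ?n - p))"
        unfolding l_def by (subst powr_mult) (use C q(2) R p in \<open>simp add: powr_powr\<close>)
      moreover have "(R / 2) powr (real ?n - p) = (R / 2) ^ ?n * (2 / R) powr p"
      proof -
        have "(R / 2) powr (real ?n - p) = (R / 2) powr real ?n * inverse ((R / 2) powr p)"
          unfolding powr_diff by (rule divide_inverse)
        also have "inverse ((R / 2) powr p) = (2 / R) powr p"
          using R inverse_powr[of "R / 2" p] by simp
        finally show ?thesis
          using R by (simp add: powr_realpow)
      qed
      ultimately have "\<kappa> * (C * q * ((R / 2) ^ ?n * (2 / R) powr p)) \<le> (2 / R) powr p * (q * (\<Omega> * R ^ ?n))"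
        by simp
      moreover have "\<kappa> * (C * q * ((R / 2) ^ ?n * (2 / R) powr p)) = 2 * ((2 / R) powr p * (q * (\<Omega> * R ^ ?n)))"
        using \<kappa>(1) by (simp add: C_def power_divide)
      moreover have "0 < (2 / R) powr p * (q * (\<Omega> * R ^ ?n))"
        using R q \<Omega> by simp
      ultimately show False
        by linarith
    qed
    have le: "Liminf (at 0) (\<lambda>x. ennreal (norm (f x) / norm x)) \<le> ennreal ((C * q) powr ?\<beta>)"
      if q: "lower_mean_at_0 Q < ennreal q" "0 < q" for q
    proof (rule ccontr)
      assume "\<not> ?thesis"
      then have "\<forall>\<^sub>F x in at 0. ennreal ((C * q) powr ?\<beta>) < ennreal (norm (f x) / norm x)"
        by (intro less_LiminfD) (simp add: not_le)
      then obtain d where "0 < d"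
          and d: "\<And>x. \<lbrakk>x \<noteq> 0; norm x < d\<rbrakk> \<Longrightarrow> ennreal ((C * q) powr ?\<beta>) < ennreal (norm (f x) / norm x)"
        unfolding eventually_at by auto
      obtain x where x: "x \<noteq> 0" "norm x < d" "norm (f x) / norm x \<le> (C * q) powr ?\<beta>"
        using small[OF q \<open>0 < d\<close>] by blast
      then show False
        using d[OF x(1,2)] ennreal_leI[OF x(3)] by (meson leD)
    qed
    obtain q0 where q0: "lower_mean_at_0 Q = ennreal q0" "0 \<le> q0"
      using fin by (cases "lower_mean_at_0 Q") auto
    have "(\<lambda>k. (C * (q0 + inverse (real (Suc k)))) powr ?\<beta>) \<longlonglongrightarrow> (C * (q0 + 0)) powr ?\<beta>"
      using C q0(2) p by (intro tendsto_intros LIMSEQ_inverse_real_of_nat) auto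
    then have lim: "(\<lambda>k. ennreal ((C * (q0 + inverse (real (Suc k)))) powr ?\<beta>)) \<longlonglongrightarrow> ennreal ((C * q0) powr ?\<beta>)"
      by (intro tendsto_ennrealI) simp
    have bound: "Liminf (at 0) (\<lambda>x. ennreal (norm (f x) / norm x))
        \<le> ennreal ((C * (q0 + inverse (real (Suc k)))) powr ?\<beta>)" for k
      using q0 by (intro le) (auto simp: ennreal_less_iff add_nonneg_pos)
    have "Liminf (at 0) (\<lambda>x. ennreal (norm (f x) / norm x)) \<le> ennreal ((C * q0) powr ?\<beta>)"
      using LIMSEQ_le_const[OF lim] bound by blast
    also have "\<dots> = ennreal (C powr ?\<beta>) * ennreal_powr (lower_mean_at_0 Q) ?\<beta>"
      using C q0 by (simp add: ennreal_powr_def powr_mult ennreal_mult)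
    finally show "Liminf (at 0) (\<lambda>x. ennreal (norm (f x) / norm x))
        \<le> ennreal (C powr ?\<beta>) * ennreal_powr (lower_mean_at_0 Q) ?\<beta>" .
  qed
qed

theorem theorem1:
  fixes p :: real
  assumes "2 \<le> CARD('n::finite)" and "1 < p" and "p < real CARD('n)"
  shows "\<exists>c0::real. 0 < c0 \<and>
    (\<forall>(Q :: real ^ 'n \<Rightarrow> ennreal) (f :: real ^ 'n \<Rightarrow> real ^ 'n).
       locally_integrable_on Q (ball 0 1) \<longrightarrow>
       lower_mean_at_0 Q < \<infinity> \<longrightarrow>
       f ` ball 0 1 \<subseteq> ball 0 1 \<longrightarrow>
       open_map (top_of_set (ball 0 1)) euclidean f \<longrightarrow>
       discrete_map_on (ball 0 1) f \<longrightarrow>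
       ring_mapping p Q (ball 0 1) f \<longrightarrow>
       f 0 = 0 \<longrightarrow>
       Liminf (at 0) (\<lambda>x. ennreal (norm (f x) / norm x))
         \<le> ennreal c0 * ennreal_powr (lower_mean_at_0 Q) (1 / (real CARD('n) - p)))"
proof -
  have dim: "DIM(real ^ 'n) = CARD('n)"
    by simp
  show ?thesis
    by (rule ring_mapping_liminf_le[where 'a = "real ^ 'n", unfolded dim, OF assms(2,3)])
      (intro exI conjI allI impI, assumption, blast)
qed

end
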